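(* Let $\mathcal{A}_\epsilon=\mathcal{A}_{\epsilon,0}+X\mathcal{A}_{\epsilon,1}+\cdots+X^d\mathcal{A}_{\epsilon,d}$ be a matrix pencil in the indeterminate $X$, where, for every $0\le k\le d$, $\mathcal{A}_{\epsilon,k}$ is an $n\times n$ matrix whose entries are complex-valued continuous functions of a nonnegative parameter $\epsilon$. Suppose that for every $0\le k\le d$ matrices $a_k\in\mathbb{C}^{n\times n}$ and $A_k\in(\mathbb{R}\cup\{+\infty\})^{n\times n}$ are given such that, when $\epsilon$ tends to $0$, $$(\mathcal{A}_{\epsilon,k})_{ij}=(a_k)_{ij}\,\epsilon^{(A_k)_{ij}}+o(\epsilon^{(A_k)_{ij}})\qquad\text{for all }1\le i,j\le n,$$ where $(A_k)_{ij}=+\infty$ means by convention that $(\mathcal{A}_{\epsilon,k})_{ij}$ is zero in a neighborhood of $\epsilon=0$. Let $A=A_0\oplus XA_1\oplus\cdots\oplus X^dA_d$ be the associated min-plus matrix pencil, and $P_A=\operatorname{perm}A$ its min-plus characteristic polynomial. Let $\gamma$ denote any finite corner of $P_A$. For every $0\le k\le d$, let $G_k$ be equal either to $\mathrm{Opt}_k(\gamma)$ or $\mathrm{Sat}_k(\gamma,U,V)$, for any choice of the Hungarian pair $(U,V)$ with respect to $\hat A(\gamma)$. Consider the auxiliary pencil $$a^{(\gamma)}:=a_0^{G_0}+Xa_1^{G_1}+\cdots+X^da_d^{G_d}.$$ Then (eigenvalues being counted with multiplicities): (1) if the pencil $a^{(\gamma)}$ has $m_\gamma$ non-zero eigenvalues,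 $\lambda_1,\dots,\lambda_{m_\gamma}$, the pencil $\mathcal{A}_\epsilon$ has $m_\gamma$ eigenvalues $\mathcal{L}_{\epsilon,1},\dots,\mathcal{L}_{\epsilon,m_\gamma}$ with respective equivalents of the form $\mathcal{L}_{\epsilon,i}\sim\lambda_i\epsilon^{\gamma}$; (2) if $0$ is an eigenvalue of multiplicity $m'_\gamma$ of the pencil $a^{(\gamma)}$, the pencil $\mathcal{A}_\epsilon$ has precisely $m'_\gamma$ eigenvalues $\mathcal{L}_\epsilon$ such that $\epsilon^{-\gamma}\mathcal{L}_\epsilon$ converges to zero, and all the other eigenvalues $\mathcal{L}_\epsilon$ of $\mathcal{A}_\epsilon$ (that is, those other than the ones just mentioned and the ones in (1)) are such that the modulus of $\epsilon^{-\gamma}\mathcal{L}_\epsilon$ converges to infinity. Moreover, for generic values of the parameters $(a_k)_{ij}$, $m_\gamma$ coincides with the multiplicity of the corner $\gamma$, and $m'_\gamma$ coincides with the sum of the multiplicities of all the corners of $P_A$ greater than $\gamma$.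
   Context: **Eigenvalues of pencils.** The eigenvalues of a matrix pencil $\mathcal{B}=\mathcal{B}_0+X\mathcal{B}_1+\cdots+X^d\mathcal{B}_d$ with complex $n\times n$ coefficients are the roots of the polynomial $\det(\mathcal{B})$ in $X$. Those of $\mathcal{A}_\epsilon$ are considered as functions of $\epsilon$, and all limits and equivalents are for $\epsilon\to0$. **Min-plus semiring.** $\mathbb{R}_{\min}=\mathbb{R}\cup\{+\infty\}$ with addition $a\oplus b=\min(a,b)$ and multiplication $ab=a\otimes b=a+b$; its zero element is $+\infty$ and its unit is $0$. **Permanent.** For an $n\times n$ matrix $B$ over a semiring, $\operatorname{perm}B$ is the sum over all permutations $\sigma$ of $\{1,\dots,n\}$ of the weights $|\sigma|_B=B_{1\sigma(1)}\cdots B_{n\sigma(n)}$. For $B\in\mathbb{R}_{\min}^{n\times n}$, $|\sigma|_B=\sum_iB_{i\sigma(i)}$ (usual sum) and $\operatorname{perm}B=\min_\sigma|\sigma|_B$. **Min-plus polynomials and corners.** The entries $A_{ij}$ of $A$ are formal polynomials in $X$ over $\mathbb{R}_{\min}$, and $P_A=\operatorname{perm}A$ is computed in the semiring of such formal polynomials. For a formal polynomial $P=\bigoplus_kP_kX^k$ over $\mathbb{R}_{\min}$, $\hat P(x)=\min_k(P_k+kx)$ is the associated polynomial function; similarly $\hat A(x)$ is the matrix with entries $\hat A_{ij}(x)=\min_{0\le k\le d}((A_k)_{ij}+kx)$. The function $\hat P$ factors uniquely as $\hat P(x)=a(x\oplus c_1)\cdots(x\oplus c_N)$ (min-plus product)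 with $N=\deg P$ and $a,c_1,\dots,c_N\in\mathbb{R}_{\min}$. The $c_i$ are the corners of $P$ (a corner may be $+\infty$); the multiplicity of a corner $c$ is the number of indices $i$ with $c_i=c$. For $c\ne+\infty$ it equals $\hat P'(c^-)-\hat P'(c^+)$; the multiplicity of the corner $+\infty$ is the valuation of $P$ (the smallest $k$ with $P_k\ne+\infty$). **Graphs.** Let $B\in\mathbb{R}_{\min}^{n\times n}$ with $\operatorname{perm}B\ne+\infty$. - $\mathrm{Opt}(B)$ is the digraph with nodes $1,\dots,n$ and an arc $(i,j)$ if there is a permutation $\sigma$ with $j=\sigma(i)$ and $|\sigma|_B=\operatorname{perm}B$. - A Hungarian pair with respect to $B$ is a pair $(U,V)$ of vectors in $\mathbb{R}^n$ with $B_{ij}\ge U_i+V_j$ for all $i,j$ and $\sum_iU_i+\sum_jV_j=\operatorname{perm}B$. - $\mathrm{Sat}(B,U,V)$ is the digraph with nodes $1,\dots,n$ and an arc $(i,j)$ if $B_{ij}=U_i+V_j$. For a finite corner $\gamma$ of $P_A$, $0\le k\le d$, and a Hungarian pair $(U,V)$ with respect to $\hat A(\gamma)$: - $\mathrm{Opt}_k(\gamma)$ has nodes $1,\dots,n$ and an arc $(i,j)$ if $(i,j)\in\mathrm{Opt}(\hat A(\gamma))$ and $(A_k)_{ij}+k\gamma=\hat A_{ij}(\gamma)$. - $\mathrm{Sat}_k(\gamma,U,V)$ has nodes $1,\dots,n$ and an arc $(i,j)$ if $(i,j)\in\mathrm{Sat}(\hat A(\gamma),U,V)$ and $(A_k)_{ij}+k\gamma=\hat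 A_{ij}(\gamma)$. For a digraph $G$ with nodes $1,\dots,n$ and $b\in\mathbb{C}^{n\times n}$, $b^G$ is the matrix with $(b^G)_{ij}=b_{ij}$ if $(i,j)\in G$ and $(b^G)_{ij}=0$ otherwise. **Generic.** The exponents $A_k$ are fixed and the word refers to the values of the coefficients $(a_k)_{ij}$, in the usual sense: outside the zero set of some nonzero polynomial in these coefficients. *)

theory Defs
  imports
    "HOL-Analysis.Analysis"
    "HOL-Library.Landau_Symbols"
    "HOL-Library.Poly_Mapping"
    "HOL-Computational_Algebra.Polynomial"
begin

section \<open>The min-plus semiring\<close>

text \<open>
  In the instance below \<open>+\<close> is the minimum and \<open>*\<close> is the usual addition, so the semiring
  constant \<open>0\<close> is \<open>+\<infinity>\<close> and the semiring constant \<open>1\<close> is the real number zero. The order is the usual one, with \<open>+\<infinity>\<close> as greatest element; it is not related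
  to the semiring constants (every element is \<open>\<le> 0\<close>).
\<close>

datatype minplus = Fin real | Infty

instantiation minplus :: "{linorder, comm_semiring_1}"
begin

fun less_eq_minplus :: "minplus \<Rightarrow> minplus \<Rightarrow> bool" where
  "Fin a \<le> Fin b \<longleftrightarrow> a \<le> b"
| "Infty \<le> Fin b \<longleftrightarrow> False"
| "x \<le> Infty \<longleftrightarrow> True"

definition less_minplus :: "minplus \<Rightarrow> minplus \<Rightarrow> bool" where
  "x < y \<longleftrightarrow> x \<le> y \<and> \<not> y \<le> x" for x y :: minplus

definition zero_minplus :: minplus where "0 = Infty"

definition one_minplus :: minplus where "1 = Fin 0"

definition plus_minplus :: "minplus \<Rightarrow> minplus \<Rightarrow> minplus" where
  "x + y = (if x \<le> y then x else y)" for x y :: minplus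

fun times_minplus :: "minplus \<Rightarrow> minplus \<Rightarrow> minplus" where
  "Fin a * Fin b = Fin (a + b)"
| "Infty * y = Infty"
| "Fin a * Infty = Infty"

instance
proof
  fix x y z :: minplus
  show "x < y \<longleftrightarrow> x \<le> y \<and> \<not> y \<le> x"
    by (simp add: less_minplus_def)
  show "x \<le> x"
    by (cases x) auto
  show "x \<le> z" if "x \<le> y" "y \<le> z"
    using that by (cases x; cases y; cases z) auto
  show "x = y" if "x \<le> y" "y \<le> x"
    using that by (cases x; cases y) auto
  show "x \<le> y \<or> y \<le> x"
    by (cases x; cases y) auto
  show "x * y * z = x * (y * z)"
    by (cases x; cases y; cases z) auto
  show "x * y = y * x"
    by (cases x; cases y) auto
  show "1 * x = x"
    by (cases x) (auto simp: one_minplus_def)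
  show "x + y + z = x + (y + z)"
    by (cases x; cases y; cases z) (auto simp: plus_minplus_def)
  show "x + y = y + x"
    by (cases x; cases y) (auto simp: plus_minplus_def)
  show "0 + x = x"
    by (cases x) (auto simp: plus_minplus_def zero_minplus_def)
  show "(x + y) * z = x * z + y * z"
    by (cases x; cases y; cases z) (auto simp: plus_minplus_def)
  show "0 * x = 0" "x * 0 = 0"
    by (cases x, auto simp: zero_minplus_def)+
  show "(0::minplus) \<noteq> 1"
    by (simp add: zero_minplus_def one_minplus_def)
qed

end

lemma plus_minplus_eq_min: "x + y = min x y" for x y :: minplus
  by (simp add: plus_minplus_def min_def)

section \<open>Permanents, pencils and eigenvalues\<close>

definition perm_weight :: "'a::comm_semiring_1 ^ 'n ^ 'n \<Rightarrow> ('n \<Rightarrow> 'n) \<Rightarrow> 'a" where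
  "perm_weight B \<sigma> = (\<Prod>i\<in>UNIV. B $ i $ \<sigma> i)"

definition perm :: "'a::comm_semiring_1 ^ 'n ^ 'n \<Rightarrow> 'a" where
  "perm B = (\<Sum>\<sigma> | \<sigma> permutes UNIV. perm_weight B \<sigma>)"

definition pencil :: "nat \<Rightarrow> (nat \<Rightarrow> 'a::comm_semiring_1 ^ 'n ^ 'n) \<Rightarrow> 'a poly ^ 'n ^ 'n" where
  "pencil d B = (\<chi> i j. \<Sum>k\<le>d. monom (B k $ i $ j) k)"

text \<open>
  Eigenvalues are counted with multiplicity. Since \<^term>\<open>proots 0 = {#}\<close>, the multiset is
  meaningful only when the determinant is a nonzero polynomial.
\<close>

definition eigenvalues :: "complex poly ^ 'n ^ 'n \<Rightarrow> complex multiset" where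
  "eigenvalues B = proots (det B)"

section \<open>Corners of min-plus polynomials\<close>

text \<open>
  \<^term>\<open>poly P\<close> is the min-plus polynomial function \<open>x \<mapsto> min\<^sub>k (P\<^sub>k + k x)\<close>, and \<open>x + c\<close> is
  \<open>min x c\<close>. For the null polynomial the multiset is empty; otherwise the factor \<open>a\<close> is
  necessarily the leading coefficient.
\<close>

definition corners :: "minplus poly \<Rightarrow> minplus multiset" where
  "corners P = (THE C. size C = degree P \<and> (\<exists>a. \<forall>x. poly P x = a * (\<Prod>c\<in>#C. x + c)))"

section \<open>Digraphs attached to an assignment problem\<close>

text \<open>Digraphs with node set \<^term>\<open>UNIV\<close> are represented by their sets of arcs.\<close>

definition eval_matrix :: "'a::comm_semiring_1 poly ^ 'n ^ 'n \<Rightarrow> 'a \<Rightarrow> 'a ^ 'n ^ 'n" where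
  "eval_matrix B x = (\<chi> i j. poly (B $ i $ j) x)"

definition Opt :: "minplus ^ 'n ^ 'n \<Rightarrow> ('n \<times> 'n) set" where
  "Opt B = {(i, j). \<exists>\<sigma>. \<sigma> permutes UNIV \<and> j = \<sigma> i \<and> perm_weight B \<sigma> = perm B}"

definition hungarian_pair :: "minplus ^ 'n ^ 'n \<Rightarrow> real ^ 'n \<Rightarrow> real ^ 'n \<Rightarrow> bool" where
  "hungarian_pair B U V \<longleftrightarrow>
     (\<forall>i j. B $ i $ j \<ge> Fin (U $ i + V $ j)) \<and>
     Fin ((\<Sum>i\<in>UNIV. U $ i) + (\<Sum>j\<in>UNIV. V $ j)) = perm B"

definition Sat :: "minplus ^ 'n ^ 'n \<Rightarrow> real ^ 'n \<Rightarrow> real ^ 'n \<Rightarrow> ('n \<times> 'n) set" where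
  "Sat B U V = {(i, j). B $ i $ j = Fin (U $ i + V $ j)}"

text \<open>
  The arcs \<open>(i, j)\<close> for which \<open>k\<close> attains the minimum defining \<open>\<hat>A\<^sub>i\<^sub>j(\<gamma>)\<close>: the min-plus
  product \<^term>\<open>A k $ i $ j * Fin (real k * \<gamma>)\<close> is the usual sum \<open>(A\<^sub>k)\<^sub>i\<^sub>j + k \<gamma>\<close>.
\<close>

definition tight_arcs :: "nat \<Rightarrow> (nat \<Rightarrow> minplus ^ 'n ^ 'n) \<Rightarrow> real \<Rightarrow> nat \<Rightarrow> ('n \<times> 'n) set" where
  "tight_arcs d A \<gamma> k =
     {(i, j). A k $ i $ j * Fin (real k * \<gamma>) = eval_matrix (pencil d A) (Fin \<gamma>) $ i $ j}"

definition Opt_level :: "nat \<Rightarrow> (nat \<Rightarrow> minplus ^ 'n ^ 'n) \<Rightarrow> real \<Rightarrow> nat \<Rightarrow> ('n \<times> 'n) set" where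
  "Opt_level d A \<gamma> k = Opt (eval_matrix (pencil d A) (Fin \<gamma>)) \<inter> tight_arcs d A \<gamma> k"

definition Sat_level ::
  "nat \<Rightarrow> (nat \<Rightarrow> minplus ^ 'n ^ 'n) \<Rightarrow> real \<Rightarrow> real ^ 'n \<Rightarrow> real ^ 'n \<Rightarrow> nat \<Rightarrow> ('n \<times> 'n) set" where
  "Sat_level d A \<gamma> U V k = Sat (eval_matrix (pencil d A) (Fin \<gamma>)) U V \<inter> tight_arcs d A \<gamma> k"

definition restrict_matrix :: "'a::zero ^ 'n ^ 'n \<Rightarrow> ('n \<times> 'n) set \<Rightarrow> 'a ^ 'n ^ 'n" where
  "restrict_matrix b G = (\<chi> i j. if (i, j) \<in> G then b $ i $ j else 0)"

definition aux_pencil ::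
  "nat \<Rightarrow> (nat \<Rightarrow> complex ^ 'n ^ 'n) \<Rightarrow> (nat \<Rightarrow> ('n \<times> 'n) set) \<Rightarrow> complex poly ^ 'n ^ 'n" where
  "aux_pencil d b G = pencil d (\<lambda>k. restrict_matrix (b k) (G k))"

section \<open>Asymptotics and genericity\<close>

definition has_leading_term :: "(real \<Rightarrow> complex) \<Rightarrow> complex \<Rightarrow> minplus \<Rightarrow> bool" where
  "has_leading_term f a e \<longleftrightarrow>
     (case e of
        Fin r \<Rightarrow> (\<lambda>\<epsilon>. f \<epsilon> - a * of_real (\<epsilon> powr r)) \<in> o[at_right 0](\<lambda>\<epsilon>. of_real (\<epsilon> powr r))
      | Infty \<Rightarrow> \<exists>\<delta>>0. \<forall>\<epsilon>\<in>{0..<\<delta>}. f \<epsilon> = 0)"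

text \<open>
  Multivariate polynomials over \<open>\<complex>\<close> in variables indexed by \<open>'v\<close>, as finitely supported
  families of coefficients indexed by finitely supported exponent vectors.
\<close>

type_synonym 'v mvpoly = "('v \<Rightarrow>\<^sub>0 nat) \<Rightarrow>\<^sub>0 complex"

definition mvpoly_vars :: "'v mvpoly \<Rightarrow> 'v set" where
  "mvpoly_vars Q = (\<Union>m\<in>Poly_Mapping.keys Q. Poly_Mapping.keys m)"

definition mvpoly_eval :: "'v mvpoly \<Rightarrow> ('v \<Rightarrow> complex) \<Rightarrow> complex" where
  "mvpoly_eval Q x = (\<Sum>m\<in>Poly_Mapping.keys Q. Poly_Mapping.lookup Q m * (\<Prod>v\<in>Poly_Mapping.keys m. x v ^ Poly_Mapping.lookup m v))"

text \<open>
  The property \<open>\<Phi>\<close> is meant to depend only on the coefficients \<open>(a\<^sub>k)\<^sub>i\<^sub>j\<close> with \<open>k \<le> d\<close>; these are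
  the only variables the polynomial may involve.
\<close>

definition generically :: "nat \<Rightarrow> ((nat \<Rightarrow> complex ^ 'n ^ 'n) \<Rightarrow> bool) \<Rightarrow> bool" where
  "generically d \<Phi> \<longleftrightarrow>
     (\<exists>Q :: (nat \<times> 'n \<times> 'n) mvpoly. Q \<noteq> 0 \<and> mvpoly_vars Q \<subseteq> {..d} \<times> UNIV \<and>
        (\<forall>a. mvpoly_eval Q (\<lambda>(k, i, j). a k $ i $ j) \<noteq> 0 \<longrightarrow> \<Phi> a))"

end

(*
  Let w be the permanent of the matrix at gamma and (U, V) a Hungarian pair. Multiplying row i by
  epsilon^(-U_i) and column j by epsilon^(-V_j), and substituting epsilon^gamma Y for X, turns the
  pencil into one whose coefficients converge to those of the auxiliary pencil with saturation
  arcs; since U and V sum to w, this divides the determinant by epsilon^w. Thus the rescaled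
  characteristic polynomials converge coefficientwise to that of the auxiliary pencil, and the
  eigenvalue asymptotics are continuity of roots, the degree being allowed to drop in the limit.
  The determinants for Opt and Sat agree because a permutation has all its arcs in Sat exactly when
  it is optimal. Generically, the auxiliary determinant has lowest and highest exponent equal to the
  smallest and largest index attaining the minimum in the min-plus polynomial at gamma; these are the
  right and left slopes there, which count the corners.
*)
theory Submission
  imports Defs "HOL-Combinatorics.Cycles" "HOL-Computational_Algebra.Fundamental_Theorem_Algebra"
begin

section \<open>Finite sums and products in the min-plus semiring\<close>

text \<open>Entrywise rescaling sees only the saturation graph: an arc that is saturated but lies on
  no optimal permutation keeps its limit. The auxiliary determinants are therefore compared term by
  term, a term being a permutation with a choice of level in each row, and a term survives under a
  condition that does not mention the graphs. The same index set expands the min-plus permanent. A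
  Hungarian pair must exist even if only optimal arcs are used, since it supplies the scaling; it
  comes from a shortest-walk potential after relabelling the columns by an optimal permutation.
  Because leading coefficients may tend to zero, roots are located by a bound in which the leading
  coefficient cancels, and are divided out one at a time; the coefficients of the quotient converge
  again, from the top down. For genericity the danger is cancellation among terms of equal exponent.
  It is excluded by evaluating at the indicator of a single optimal term, and one nonzero value
  certifies a nonzero polynomial.\<close>

fun real_of_minplus :: "minplus \<Rightarrow> real" where
  "real_of_minplus (Fin x) = x"
| "real_of_minplus Infty = 0"

lemma minplus_le_Infty [simp]: "x \<le> Infty"
  by (cases x) auto

lemma Infty_le_iff [simp]: "Infty \<le> x \<longleftrightarrow> x = Infty"
  by (cases x) auto

lemma Fin_less_iff [simp]: "Fin a < Fin b \<longleftrightarrow> a < b"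
  by (auto simp: less_minplus_def)

lemma Fin_less_Infty [simp]: "Fin a < Infty"
  by (auto simp: less_minplus_def)

lemma times_Infty [simp]: "x * Infty = Infty"
  by (cases x) auto

lemma times_eq_Infty_iff [simp]: "x * y = Infty \<longleftrightarrow> x = Infty \<or> y = Infty"
  by (cases x; cases y) auto

lemma Fin_power: "Fin x ^ k = Fin (real k * x)"
  by (induction k) (auto simp: one_minplus_def algebra_simps)

lemma Infty_power: "Infty ^ k = (if k = 0 then Fin 0 else Infty)"
  by (cases k) (auto simp: one_minplus_def)

lemma times_minplus_mono: "x \<le> x' \<Longrightarrow> y \<le> y' \<Longrightarrow> x * y \<le> x' * y'" for x y :: minplus
  by (cases x; cases x'; cases y; cases y') auto

lemma le_sum_minplus_iff:
  "finite S \<Longrightarrow> z \<le> sum f S \<longleftrightarrow> (\<forall>s\<in>S. z \<le> f s)" for f :: "'a \<Rightarrow> minplus"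
  by (induction S rule: finite_induct) (auto simp: plus_minplus_eq_min zero_minplus_def)

lemma sum_minplus_le: "finite S \<Longrightarrow> s \<in> S \<Longrightarrow> sum f S \<le> f s" for f :: "'a \<Rightarrow> minplus"
  using le_sum_minplus_iff[of S "sum f S" f] by auto

lemma sum_minplus_attained:
  fixes f :: "'a \<Rightarrow> minplus"
  shows "finite S \<Longrightarrow> sum f S \<noteq> Infty \<Longrightarrow> \<exists>s\<in>S. f s = sum f S"
proof (induction S rule: finite_induct)
  case (insert x S)
  then show ?case
    by (cases "f x \<le> sum f S") (auto simp: plus_minplus_eq_min min_def)
qed (auto simp: zero_minplus_def)

lemma prod_Fin: "(\<Prod>i\<in>S. Fin (f i)) = Fin (\<Sum>i\<in>S. f i)"
  by (induction S rule: infinite_finite_induct) (auto simp: one_minplus_def)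

lemma prod_minplus_eq_Infty_iff:
  "finite S \<Longrightarrow> prod f S = Infty \<longleftrightarrow> (\<exists>s\<in>S. f s = Infty)"
  by (induction S rule: finite_induct) (auto simp: one_minplus_def)

lemma prod_minplus_mono:
  "(\<And>i. i \<in> S \<Longrightarrow> f i \<le> g i) \<Longrightarrow> prod f S \<le> prod g S" for f :: "'a \<Rightarrow> minplus"
  by (induction S rule: infinite_finite_induct) (auto intro: times_minplus_mono)

text \<open>Among finite values the product is a real sum, so one strict factor would make the total
  strict. Finiteness matters: a factor \<open>Infty\<close> would absorb the difference. This turns
  optimality of a total weight into tightness of every arc.\<close>

lemma prod_minplus_mono_eq:
  fixes f g :: "'a \<Rightarrow> minplus"
  assumes "finite S" "\<And>i. i \<in> S \<Longrightarrow> f i \<le> g i" "prod g S \<le> prod f S" "prod f S \<noteq> Infty" "i \<in> S"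
  shows "f i = g i"
proof -
  have "prod g S \<noteq> Infty"
    using assms by (metis Infty_le_iff)
  then have g: "g i = Fin (real_of_minplus (g i))" if "i \<in> S" for i
    using that assms(1) by (cases "g i") (auto simp: prod_minplus_eq_Infty_iff)
  have f: "f i = Fin (real_of_minplus (f i))" if "i \<in> S" for i
    using that assms(1,4) by (cases "f i") (auto simp: prod_minplus_eq_Infty_iff)
  have "prod g S = Fin (\<Sum>i\<in>S. real_of_minplus (g i))" "prod f S = Fin (\<Sum>i\<in>S. real_of_minplus (f i))"
    by (subst prod_Fin[symmetric], rule prod.cong, use f g in auto)+
  then have *: "(\<Sum>i\<in>S. real_of_minplus (g i)) \<le> (\<Sum>i\<in>S. real_of_minplus (f i))"
    using assms(3) by simp
  have le: "real_of_minplus (f i) \<le> real_of_minplus (g i)" if "i \<in> S" for i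
    using assms(2)[OF that] f[OF that] g[OF that] by (metis less_eq_minplus.simps(1))
  have "real_of_minplus (f i) = real_of_minplus (g i)"
  proof (rule ccontr)
    assume "real_of_minplus (f i) \<noteq> real_of_minplus (g i)"
    then have "real_of_minplus (f i) < real_of_minplus (g i)"
      using le[OF assms(5)] by simp
    then have "(\<Sum>i\<in>S. real_of_minplus (f i)) < (\<Sum>i\<in>S. real_of_minplus (g i))"
      using assms(1,5) le by (intro sum_strict_mono_ex1) auto
    then show False using * by simp
  qed
  then show ?thesis
    using f g assms(5) by metis
qed

lemma perm_le_perm_weight:
  "\<sigma> permutes UNIV \<Longrightarrow> perm B \<le> perm_weight B \<sigma>" for B :: "minplus ^ 'n ^ 'n"
  unfolding perm_def by (rule sum_minplus_le) (auto simp: finite_permutations)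

lemma perm_attained:
  fixes B :: "minplus ^ 'n ^ 'n"
  assumes "perm B \<noteq> Infty"
  obtains \<tau> where "\<tau> permutes UNIV" "perm_weight B \<tau> = perm B"
  using sum_minplus_attained[of "{\<sigma>. \<sigma> permutes (UNIV :: 'n set)}" "perm_weight B"] assms
  by (auto simp: finite_permutations perm_def)

section \<open>Existence of Hungarian pairs\<close>

fun walk_weight :: "('a \<Rightarrow> 'a \<Rightarrow> real) \<Rightarrow> 'a list \<Rightarrow> real" where
  "walk_weight c (x # y # zs) = c x y + walk_weight c (y # zs)"
| "walk_weight c zs = 0"

text \<open>Weights sit on consecutive pairs, so the node \<open>y\<close> where the walk is cut
  belongs to both pieces.\<close>

lemma walk_weight_append:
  "walk_weight c (xs @ y # ys) = walk_weight c (xs @ [y]) + walk_weight c (y # ys)"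
  by (induction xs rule: induct_list012) auto

lemma walk_weight_snoc:
  "xs \<noteq> [] \<Longrightarrow> walk_weight c (xs @ [y]) = sum_list (map2 c xs (tl xs @ [y]))"
proof (induction xs rule: induct_list012)
  case (3 x z xs)
  then show ?case by simp
qed auto

text \<open>Cutting at a repeated node splits a closed walk into two shorter ones, down to simple
  cycles. A simple cycle extends to a permutation by fixing all other nodes, and the zero diagonal
  makes the fixed nodes free.\<close>

lemma closed_walk_weight_nonneg:
  fixes c :: "'a::finite \<Rightarrow> 'a \<Rightarrow> real"
  assumes perm: "\<And>\<sigma>. \<sigma> permutes UNIV \<Longrightarrow> (\<Sum>i\<in>UNIV. c i (\<sigma> i)) \<ge> 0" and diag: "\<And>i. c i i = 0"
    and "xs \<noteq> []"
  shows "walk_weight c (xs @ [hd xs]) \<ge> 0"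
  using \<open>xs \<noteq> []\<close>
proof (induction "length xs" arbitrary: xs rule: less_induct)
  case less
  show ?case
  proof (cases "distinct xs")
    case True
    define \<sigma> where "\<sigma> = cycle_of_list xs"
    have \<sigma>: "\<sigma> permutes UNIV"
      unfolding \<sigma>_def by (rule permutes_subset[OF cycle_permutes]) simp
    have rot: "map \<sigma> xs = tl xs @ [hd xs]"
      using cyclic_rotation[OF True, of 1] less.prems by (simp add: \<sigma>_def rotate1_hd_tl)
    have "walk_weight c (xs @ [hd xs]) = sum_list (map2 c xs (map \<sigma> xs))"
      using walk_weight_snoc[OF less.prems] rot by simp
    also have "map2 c xs (map \<sigma> xs) = map (\<lambda>x. c x (\<sigma> x)) xs"
      by (induction xs) auto
    also have "sum_list \<dots> = (\<Sum>x\<in>set xs. c x (\<sigma> x))"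
      using True by (rule sum_list_distinct_conv_sum_set)
    also have "\<dots> = (\<Sum>x\<in>UNIV. c x (\<sigma> x))"
      by (rule sum.mono_neutral_left) (auto simp: \<sigma>_def id_outside_supp diag)
    finally show ?thesis
      using perm[OF \<sigma>] by simp
  next
    case False
    then obtain as y bs cs where xs: "xs = as @ [y] @ bs @ [y] @ cs"
      using not_distinct_decomp by blast
    have 1: "walk_weight c ((y # bs) @ [hd (y # bs)]) \<ge> 0"
      using xs by (intro less.hyps) auto
    have 2: "walk_weight c ((as @ y # cs) @ [hd (as @ y # cs)]) \<ge> 0"
      using xs by (intro less.hyps) auto
    have hd: "hd (as @ y # cs) = hd xs"
      using xs by (cases as) auto
    have "walk_weight c (xs @ [hd xs]) =
        walk_weight c (as @ [y]) + walk_weight c (y # bs @ [y]) + walk_weight c (y # cs @ [hd xs])"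
      using walk_weight_append[of c as y "bs @ y # cs @ [hd xs]"]
        walk_weight_append[of c "y # bs" y "cs @ [hd xs]"] by (simp add: xs)
    also have "\<dots> = walk_weight c (as @ y # cs @ [hd xs]) + walk_weight c ((y # bs) @ [y])"
      using walk_weight_append[of c as y "cs @ [hd xs]"] by simp
    finally show ?thesis
      using 1 2 hd by simp
  qed
qed

text \<open>
  The potential is the distance from a fixed node; closing a walk to \<open>j\<close> by the arc back to the
  root bounds its weight from below.
\<close>

lemma exists_potential:
  fixes c :: "'a::finite \<Rightarrow> 'a \<Rightarrow> real"
  assumes "\<And>\<sigma>. \<sigma> permutes UNIV \<Longrightarrow> (\<Sum>i\<in>UNIV. c i (\<sigma> i)) \<ge> 0" and "\<And>i. c i i = 0"
  obtains p where "\<And>i j. p j \<le> p i + c i j"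
proof -
  obtain r :: 'a where True by simp
  define S where "S j = range (\<lambda>xs. walk_weight c (r # xs @ [j]))" for j
  have bdd: "bdd_below (S j)" for j
  proof (rule bdd_belowI)
    fix w assume "w \<in> S j"
    then obtain xs where w: "w = walk_weight c (r # xs @ [j])"
      by (auto simp: S_def)
    have "walk_weight c ((r # xs @ [j]) @ [hd (r # xs @ [j])]) \<ge> 0"
      by (rule closed_walk_weight_nonneg) (use assms in auto)
    then show "w \<ge> - c j r"
      using walk_weight_append[of c "r # xs" j "[r]"] w by simp
  qed
  have "Inf (S j) \<le> Inf (S i) + c i j" for i j
  proof -
    have "Inf (S j) - c i j \<le> Inf (S i)"
    proof (rule cInf_greatest)
      show "S i \<noteq> {}" by (auto simp: S_def)
      fix w assume "w \<in> S i"
      then obtain xs where w: "w = walk_weight c (r # xs @ [i])"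
        by (auto simp: S_def)
      have "walk_weight c (r # (xs @ [i]) @ [j]) \<in> S j"
        unfolding S_def by blast
      then have "Inf (S j) \<le> walk_weight c (r # (xs @ [i]) @ [j])"
        using bdd by (rule cInf_lower)
      then show "Inf (S j) - c i j \<le> w"
        using walk_weight_append[of c "r # xs" i "[j]"] w by simp
    qed
    then show ?thesis by simp
  qed
  then show ?thesis
    by (rule that)
qed

text \<open>Strong duality for the assignment problem. Relative to an optimal \<open>\<tau>\<close>,
  and with columns relabelled by it, the costs have zero diagonal and nonnegative permutation sums.
  A potential for them gives the dual variables.\<close>

lemma exists_hungarian_pair:
  fixes B :: "minplus ^ 'n ^ 'n"
  assumes "perm B \<noteq> Infty"
  obtains U V where "hungarian_pair B U V"
proof -
  obtain w where w: "perm B = Fin w"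
    using assms by (cases "perm B") auto
  obtain \<tau> where \<tau>: "\<tau> permutes UNIV" "perm_weight B \<tau> = perm B"
    using perm_attained[OF assms] .
  define b where "b i j = real_of_minplus (B $ i $ j)" for i j
  define s where "s i = (\<Sum>j\<in>UNIV. \<bar>b i j\<bar>)" for i
  define M where "M = \<bar>w\<bar> + sum s UNIV"
  \<comment> \<open>Infinite entries are replaced by a real number large enough not to create new optimal permutations.\<close>
  define W where "W i j = (if B $ i $ j = Infty then M else b i j)" for i j
  have s: "s i \<ge> \<bar>b i j\<bar>" for i j
    unfolding s_def by (rule member_le_sum) auto
  have "s i \<ge> 0" for i
    unfolding s_def by (rule sum_nonneg) auto
  then have "M \<ge> 0"
    unfolding M_def by (simp add: sum_nonneg)
  have finite_weight: "perm_weight B \<sigma> = Fin (\<Sum>i\<in>UNIV. W i (\<sigma> i))" if "perm_weight B \<sigma> \<noteq> Infty" for \<sigma>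
  proof -
    have "B $ i $ \<sigma> i \<noteq> Infty" for i
      using that by (auto simp: perm_weight_def prod_minplus_eq_Infty_iff)
    then have "B $ i $ \<sigma> i = Fin (W i (\<sigma> i))" for i
      by (cases "B $ i $ \<sigma> i") (auto simp: W_def b_def)
    then show ?thesis
      by (simp add: perm_weight_def prod_Fin)
  qed
  have W_\<tau>: "(\<Sum>i\<in>UNIV. W i (\<tau> i)) = w"
    using finite_weight[of \<tau>] \<tau> w by simp
  have W_ge: "(\<Sum>i\<in>UNIV. W i (\<sigma> i)) \<ge> w" if \<sigma>: "\<sigma> permutes UNIV" for \<sigma>
  proof (cases "perm_weight B \<sigma> = Infty")
    case False
    then show ?thesis
      using perm_le_perm_weight[OF \<sigma>, of B] finite_weight[OF False] w by simp
  next
    case True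
    then obtain k where k: "B $ k $ \<sigma> k = Infty"
      by (auto simp: perm_weight_def prod_minplus_eq_Infty_iff)
    \<comment> \<open>Adding \<open>s i\<close> makes every summand nonnegative, so the arc of value
      \<open>M\<close> alone bounds the sum from below. The part \<open>sum s UNIV\<close> of
      \<open>M\<close> pays for these additions.\<close>
    have nonneg: "W i (\<sigma> i) + s i \<ge> 0" for i
      using s[of i "\<sigma> i"] \<open>M \<ge> 0\<close> \<open>s i \<ge> 0\<close> by (auto simp: W_def)
    have "M \<le> W k (\<sigma> k) + s k"
      using k \<open>s k \<ge> 0\<close> by (simp add: W_def)
    also have "\<dots> \<le> (\<Sum>i\<in>UNIV. W i (\<sigma> i) + s i)"
      by (rule member_le_sum) (use nonneg in auto)
    finally show ?thesis
      unfolding M_def by (simp add: sum.distrib)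
  qed
  \<comment> \<open>Node \<open>j\<close> stands for column \<open>\<tau> j\<close>: this is the
    change of cost when row \<open>i\<close> takes the column that \<open>\<tau>\<close> assigns to
    row \<open>j\<close>.\<close>
  define c where "c i j = W i (\<tau> j) - W i (\<tau> i)" for i j
  have "(\<Sum>i\<in>UNIV. c i (\<sigma> i)) \<ge> 0" if "\<sigma> permutes UNIV" for \<sigma>
    using W_ge[OF permutes_compose[OF that \<tau>(1)]] W_\<tau> by (simp add: c_def sum_subtractf)
  then obtain p where p: "\<And>i j. p j \<le> p i + c i j"
    using exists_potential[of c] by (auto simp: c_def)
  define U :: "real ^ 'n" where "U = (\<chi> i. W i (\<tau> i) - p i)"
  define V :: "real ^ 'n" where "V = (\<chi> j. p (inv \<tau> j))"
  have "Fin (U $ i + V $ j) \<le> B $ i $ j" for i j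
  proof (cases "B $ i $ j")
    case (Fin x)
    then show ?thesis
      using p[of "inv \<tau> j" i] permutes_inverses(1)[OF \<tau>(1), of j]
      by (simp add: U_def V_def c_def W_def b_def)
  qed simp
  moreover have "(\<Sum>j\<in>UNIV. V $ j) = (\<Sum>i\<in>UNIV. p i)"
    unfolding V_def using sum.permute[OF permutes_inv[OF \<tau>(1)], of p] by (simp add: o_def)
  then have "(\<Sum>i\<in>UNIV. U $ i) + (\<Sum>j\<in>UNIV. V $ j) = w"
    using W_\<tau> by (simp add: U_def sum_subtractf)
  ultimately have "hungarian_pair B U V"
    by (simp add: hungarian_pair_def w)
  then show ?thesis ..
qed

section \<open>Corners of min-plus polynomials\<close>

lemma minplus_poly_eq_sum: "poly P (Fin x) = (\<Sum>k\<le>degree P. coeff P k * Fin (real k * x))"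
  by (simp add: poly_altdef Fin_power)

lemma minplus_sum_at_Infty: "(\<Sum>k\<le>N. p k * Infty ^ k) = p 0" for p :: "nat \<Rightarrow> minplus"
proof -
  have "(\<Sum>k\<le>N. p k * Infty ^ k) = (\<Sum>k\<le>N. if k = 0 then p 0 else 0)"
  proof (rule sum.cong)
    fix k show "p k * Infty ^ k = (if k = 0 then p 0 else 0)"
      by (cases "p 0") (auto simp: Infty_power zero_minplus_def)
  qed simp
  then show ?thesis by simp
qed

text \<open>
  Splits off the smallest corner \<open>c\<close>: to the left of \<open>c\<close> the leading monomial is minimal, and to
  the right of \<open>c\<close> the monomials of degree larger than some \<open>m\<close> attaining the slope \<open>c\<close> can be dropped.
\<close>

lemma minplus_sum_factorization:
  fixes p :: "nat \<Rightarrow> minplus"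
  assumes "p N \<noteq> Infty"
  shows "\<exists>C a. size C = N \<and> (\<forall>x. (\<Sum>k\<le>N. p k * x ^ k) = a * (\<Prod>c\<in>#C. x + c))"
  using assms
proof (induction N rule: less_induct)
  case (less N)
  show ?case
  proof (cases "\<forall>k<N. p k = Infty")
    case True
    have "(\<Sum>k\<le>N. p k * x ^ k) = p N * x ^ N" for x
    proof -
      have "(\<Sum>k\<le>N. p k * x ^ k) = (\<Sum>k\<in>{N}. p k * x ^ k)"
        by (rule sum.mono_neutral_right) (use True in \<open>auto simp: zero_minplus_def\<close>)
      then show ?thesis by simp
    qed
    moreover have "x + Infty = x" for x
      using add_0_right[of x] by (simp add: zero_minplus_def)
    ultimately show ?thesis
      by (intro exI[of _ "replicate_mset N Infty"] exI[of _ "p N"]) simp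
  next
    case False
    define r where "r k = real_of_minplus (p k)" for k
    define K where "K = {k. k < N \<and> p k \<noteq> Infty}"
    \<comment> \<open>The abscissa at which the monomials of degrees \<open>k\<close> and
      \<open>N\<close> take the same value. Left of all of them the leading monomial is minimal,
      whence the minimum in \<open>c\<close>.\<close>
    define f where "f k = (r k - r N) / (real N - real k)" for k
    define c where "c = Min (f ` K)"
    have K: "finite K" "K \<noteq> {}"
      using False by (auto simp: K_def)
    then have "c \<in> f ` K"
      unfolding c_def by (intro Min_in) auto
    then obtain m where m: "m \<in> K" "c = f m"
      by auto
    then have mN: "m < N" "p m \<noteq> Infty"
      by (auto simp: K_def)
    have p_fin: "p k = Fin (r k)" if "p k \<noteq> Infty" for k
      using that by (cases "p k") (auto simp: r_def)
    \<comment> \<open>Newton polygon: the points \<open>(k, r k)\<close> lie on or above the line of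
      slope \<open>- c\<close> through \<open>(N, r N)\<close>, and \<open>m\<close> gives a point
      on it.\<close>
    have lower: "r k \<ge> r N + (real N - real k) * c" if "k \<le> N" "p k \<noteq> Infty" for k
    proof (cases "k = N")
      case False
      then have "c \<le> f k"
        using that K unfolding c_def K_def by (intro Min_le) auto
      then show ?thesis
        using that False by (simp add: f_def field_simps)
    qed simp
    have r_m: "r m = r N + (real N - real m) * c"
      using m mN by (simp add: f_def)
    obtain C a where C: "size C = m" "\<And>x. (\<Sum>k\<le>m. p k * x ^ k) = a * (\<Prod>c\<in>#C. x + c)"
      using less.IH[OF mN] by blast
    \<comment> \<open>Right of \<open>c\<close> the last factor is constantly
      \<open>(N - m) c\<close> in real terms; the leading constant cancels it.\<close>
    have eq: "(\<Sum>k\<le>N. p k * x ^ k) =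
        Fin (- (real N - real m) * c) * (\<Sum>k\<le>m. p k * x ^ k) * (x + Fin c) ^ (N - m)" for x
    proof (cases x)
      case Infty
      then show ?thesis
        using mN by (cases "p 0")
          (simp_all add: minplus_sum_at_Infty plus_minplus_def Fin_power of_nat_diff algebra_simps)
    next
      case (Fin t)
      have low_N: "Fin y \<le> p k * Fin (real k * t)" if "p k \<noteq> Infty \<Longrightarrow> y \<le> r k + real k * t" for k y
        using that p_fin[of k] by (cases "p k = Infty") auto
      show ?thesis
      proof (cases "t \<le> c")
        case True
        have "Fin (r N + real N * t) \<le> p k * Fin (real k * t)" if "k \<le> N" for k
        proof (rule low_N)
          assume "p k \<noteq> Infty"
          have "(real N - real k) * t \<le> (real N - real k) * c"
            using True that by (intro mult_left_mono) auto
          then show "r N + real N * t \<le> r k + real k * t"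
            using lower[OF that \<open>p k \<noteq> Infty\<close>] by (simp add: algebra_simps)
        qed
        then have "Fin (r N + real N * t) \<le> (\<Sum>k\<le>N. p k * x ^ k)"
          by (simp add: le_sum_minplus_iff Fin Fin_power)
        moreover have "(\<Sum>k\<le>N. p k * x ^ k) \<le> p N * x ^ N"
          by (rule sum_minplus_le) auto
        ultimately have f: "(\<Sum>k\<le>N. p k * x ^ k) = Fin (r N + real N * t)"
          using p_fin[OF less.prems] by (auto simp: Fin Fin_power)
        have "Fin (r m + real m * t) \<le> p k * Fin (real k * t)" if "k \<le> m" for k
        proof (rule low_N)
          assume "p k \<noteq> Infty"
          have "(real m - real k) * t \<le> (real m - real k) * c"
            using True that by (intro mult_left_mono) auto
          then show "r m + real m * t \<le> r k + real k * t"
            using lower[of k] \<open>p k \<noteq> Infty\<close> that mN r_m by (simp add: algebra_simps)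
        qed
        then have "Fin (r m + real m * t) \<le> (\<Sum>k\<le>m. p k * x ^ k)"
          by (simp add: le_sum_minplus_iff Fin Fin_power)
        moreover have "(\<Sum>k\<le>m. p k * x ^ k) \<le> p m * x ^ m"
          by (rule sum_minplus_le) auto
        ultimately have g: "(\<Sum>k\<le>m. p k * x ^ k) = Fin (r m + real m * t)"
          using p_fin[OF mN(2)] by (auto simp: Fin Fin_power)
        have "x + Fin c = Fin t"
          using True by (simp add: Fin plus_minplus_def)
        then show ?thesis
          using f g r_m mN by (simp add: Fin_power of_nat_diff algebra_simps)
      next
        case False
        have "(\<Sum>k\<le>m. p k * x ^ k) \<le> p k * x ^ k" if "k \<le> N" for k
        proof (cases "k \<le> m")
          case True
          then show ?thesis
            by (intro sum_minplus_le) auto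
        next
          case km: False
          have "(\<Sum>k\<le>m. p k * x ^ k) \<le> p m * x ^ m"
            by (rule sum_minplus_le) auto
          also have "\<dots> = Fin (r m + real m * t)"
            using p_fin[OF mN(2)] by (simp add: Fin Fin_power)
          also have "\<dots> \<le> p k * Fin (real k * t)"
          proof (rule low_N)
            assume "p k \<noteq> Infty"
            have "(real k - real m) * c \<le> (real k - real m) * t"
              using False km by (intro mult_left_mono) auto
            then show "r m + real m * t \<le> r k + real k * t"
              using lower[of k] \<open>p k \<noteq> Infty\<close> that mN r_m by (simp add: algebra_simps)
          qed
          finally show ?thesis
            by (simp add: Fin Fin_power)
        qed
        then have "(\<Sum>k\<le>m. p k * x ^ k) \<le> (\<Sum>k\<le>N. p k * x ^ k)"
          by (simp add: le_sum_minplus_iff)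
        moreover have "(\<Sum>k\<le>N. p k * x ^ k) \<le> (\<Sum>k\<le>m. p k * x ^ k)"
          using mN by (auto simp: le_sum_minplus_iff intro!: sum_minplus_le)
        ultimately have fg: "(\<Sum>k\<le>N. p k * x ^ k) = (\<Sum>k\<le>m. p k * x ^ k)"
          by simp
        have "x + Fin c = Fin c"
          using False by (simp add: Fin plus_minplus_def)
        then show ?thesis
          unfolding fg using mN
          by (cases "\<Sum>k\<le>m. p k * x ^ k") (simp_all add: Fin_power of_nat_diff algebra_simps)
      qed
    qed
    show ?thesis
    proof (intro exI conjI allI)
      show "size (C + replicate_mset (N - m) (Fin c)) = N"
        using C mN by simp
      show "(\<Sum>k\<le>N. p k * x ^ k) =
          Fin (- (real N - real m) * c) * a * (\<Prod>c\<in>#C + replicate_mset (N - m) (Fin c). x + c)" for x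
        unfolding eq C(2) by (simp add: mult.assoc)
    qed
  qed
qed

section \<open>One-sided slopes of a product of corners, and uniqueness of the corners\<close>

abbreviation corner_sum :: "minplus multiset \<Rightarrow> real \<Rightarrow> real" where
  "corner_sum C x \<equiv> (\<Sum>c\<in>#C. real_of_minplus (Fin x + c))"

text \<open>Each \<open>Fin x + c\<close> is at most \<open>Fin x\<close>, hence never
  \<open>Infty\<close>, and the passage to real numbers loses nothing, even for infinite
  corners.\<close>

lemma corner_prod_eq: "(\<Prod>c\<in>#C. Fin x + c) = Fin (corner_sum C x)"
proof (induction C)
  case (add c C)
  then show ?case
    by (cases c) (auto simp: plus_minplus_def)
qed (simp add: one_minplus_def)

lemma eventually_at_right_0_le: "0 < e \<Longrightarrow> \<forall>\<^sub>F h in at_right 0. h * r \<le> e" for e r :: real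
proof -
  assume "0 < e"
  have "((\<lambda>h. h * r) \<longlongrightarrow> 0 * r) (at_right 0)"
    by (intro tendsto_intros)
  then have "\<forall>\<^sub>F h in at_right 0. h * r < e"
    by (rule order_tendstoD(2)) (use \<open>0 < e\<close> in simp)
  then show ?thesis
    by eventually_elim simp
qed

text \<open>For small \<open>h\<close> the minimum of \<open>x + h\<close> and \<open>c\<close>
  still grows only if \<open>c\<close> lies strictly to the right; an infinite corner always counts.
  An exact identity for small \<open>h\<close> replaces a derivative, so that slopes are compared by
  linear arithmetic.\<close>

lemma corner_sum_right:
  "\<forall>\<^sub>F h in at_right 0.
     corner_sum C (x + h) = corner_sum C x + h * real (size {#c \<in># C. c > Fin x#})"
proof (induction C)
  case (add c C)
  have "\<forall>\<^sub>F h in at_right 0. real_of_minplus (Fin (x + h) + c) =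
      real_of_minplus (Fin x + c) + h * (if c > Fin x then 1 else 0)"
  proof (cases c)
    case Infty
    then show ?thesis by (simp add: plus_minplus_def)
  next
    case (Fin y)
    show ?thesis
    proof (cases "x < y")
      case True
      have "\<forall>\<^sub>F h in at_right 0. h * 1 \<le> y - x"
        by (rule eventually_at_right_0_le) (use True in simp)
      then show ?thesis
        by eventually_elim (use True Fin in \<open>auto simp: plus_minplus_def\<close>)
    next
      case False
      have "\<forall>\<^sub>F h::real in at_right 0. h > 0"
        by (rule eventually_at_right_less)
      then show ?thesis
        by eventually_elim (use False Fin in \<open>auto simp: plus_minplus_def\<close>)
    qed
  qed
  with add.IH show ?case
    by eventually_elim (auto simp: algebra_simps)
qed simp

text \<open>Here a corner at \<open>x\<close> itself counts, in contrast to the right side: its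
  multiplicity is the drop of the slope.\<close>

lemma corner_sum_left:
  "\<forall>\<^sub>F h in at_right 0.
     corner_sum C (x - h) = corner_sum C x - h * real (size {#c \<in># C. c \<ge> Fin x#})"
proof (induction C)
  case (add c C)
  have "\<forall>\<^sub>F h in at_right 0. real_of_minplus (Fin (x - h) + c) =
      real_of_minplus (Fin x + c) - h * (if c \<ge> Fin x then 1 else 0)"
  proof (cases c)
    case Infty
    then show ?thesis by (simp add: plus_minplus_def)
  next
    case (Fin y)
    show ?thesis
    proof (cases "y < x")
      case True
      have "\<forall>\<^sub>F h in at_right 0. h * 1 \<le> x - y"
        by (rule eventually_at_right_0_le) (use True in simp)
      then show ?thesis
        by eventually_elim (use True Fin in \<open>auto simp: plus_minplus_def\<close>)
    next
      case False
      have "\<forall>\<^sub>F h::real in at_right 0. h > 0"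
        by (rule eventually_at_right_less)
      then show ?thesis
        by eventually_elim (use False Fin in \<open>auto simp: plus_minplus_def\<close>)
    qed
  qed
  with add.IH show ?case
    by eventually_elim (auto simp: algebra_simps)
qed simp

lemma size_filter_ge_eq:
  "size {#c \<in># C. c \<ge> x#} = count C x + size {#c \<in># C. c > x#}" for x :: "'a::linorder"
  by (induction C) auto

text \<open>Finite multiplicities are drops of slope of one and the same function. The corner
  \<open>Infty\<close> produces no such drop at a finite point; its multiplicity is what the equal
  sizes leave over.\<close>

lemma corner_multiset_unique:
  assumes "size C = size C'" and "a \<noteq> Infty" "a' \<noteq> Infty"
    and eq: "\<And>x. a * (\<Prod>c\<in>#C. x + c) = a' * (\<Prod>c\<in>#C'. x + c)"
  shows "C = C'"
proof -
  obtain r r' where r: "a = Fin r" "a' = Fin r'"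
    using assms(2,3) by (cases a; cases a') auto
  have F: "r + corner_sum C x = r' + corner_sum C' x" for x
    using eq[of "Fin x"] by (simp add: r corner_prod_eq)
  have count: "count C (Fin x) = count C' (Fin x)" for x
  proof -
    have "\<forall>\<^sub>F h::real in at_right 0. h > 0"
      by (rule eventually_at_right_less)
    with corner_sum_right[of x C] corner_sum_right[of x C'] corner_sum_left[of x C] corner_sum_left[of x C']
    have "\<forall>\<^sub>F h::real in at_right 0. count C (Fin x) = count C' (Fin x)"
    proof eventually_elim
      case (elim h)
      have "h * real (size {#c \<in># C. c > Fin x#}) = h * real (size {#c \<in># C'. c > Fin x#})"
        using elim(1,2) F[of x] F[of "x + h"] by linarith
      moreover have "h * real (size {#c \<in># C. c \<ge> Fin x#}) = h * real (size {#c \<in># C'. c \<ge> Fin x#})"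
        using elim(3,4) F[of x] F[of "x - h"] by linarith
      ultimately show ?case
        using elim by (simp add: size_filter_ge_eq)
    qed
    then show ?thesis by simp
  qed
  have "{#c \<in># C. c \<noteq> Infty#} = {#c \<in># C'. c \<noteq> Infty#}"
  proof (rule multiset_eqI)
    fix c show "count {#c \<in># C. c \<noteq> Infty#} c = count {#c \<in># C'. c \<noteq> Infty#} c"
      using count by (cases c) auto
  qed
  moreover have "size D = count D Infty + size {#c \<in># D. c \<noteq> Infty#}" for D
    by (induction D) auto
  ultimately have "count C Infty = count C' Infty"
    using assms(1) by (metis add_right_cancel)
  then show ?thesis
    using count by (intro multiset_eqI) (metis minplus.exhaust)
qed

section \<open>The multiset of corners and its multiplicities\<close>

lemma corners_0 [simp]: "corners 0 = {#}"
proof -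
  have "poly 0 x = 0 * (\<Prod>c\<in>#{#}. x + c)" for x :: minplus
    by simp
  then show ?thesis
    unfolding corners_def by (intro the_equality) (auto intro!: exI[of _ 0])
qed

lemma poly_minplus_neq_Infty: "P \<noteq> 0 \<Longrightarrow> poly P (Fin x) \<noteq> Infty"
proof
  assume "P \<noteq> 0" "poly P (Fin x) = Infty"
  then have "Infty \<le> coeff P (degree P) * Fin (real (degree P) * x)"
    using sum_minplus_le[of "{..degree P}" "degree P" "\<lambda>k. coeff P k * Fin (real k * x)"]
    by (simp add: minplus_poly_eq_sum)
  then have "lead_coeff P = 0"
    by (simp add: zero_minplus_def)
  then show False
    using \<open>P \<noteq> 0\<close> by simp
qed

text \<open>Resolves the definite description in \<open>corners\<close>. A factor
  \<open>a = Infty\<close> would absorb every multiset and destroy uniqueness; it is excluded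
  because a nonzero polynomial is finite at finite points.\<close>

lemma corners_factorization:
  assumes "P \<noteq> 0"
  obtains a where "size (corners P) = degree P" "\<And>x. poly P x = Fin a * (\<Prod>c\<in>#corners P. x + c)"
proof -
  define Q where "Q C \<longleftrightarrow> size C = degree P \<and> (\<exists>a. \<forall>x. poly P x = a * (\<Prod>c\<in>#C. x + c))" for C
  have "lead_coeff P \<noteq> Infty"
    using assms by (metis leading_coeff_0_iff zero_minplus_def)
  from minplus_sum_factorization[of "coeff P", OF this] have "\<exists>C. Q C"
    by (auto simp: Q_def poly_altdef)
  moreover have fin: "a \<noteq> Infty" if "\<forall>x. poly P x = a * (\<Prod>c\<in>#C. x + c)" for a C
    using that poly_minplus_neq_Infty[OF assms, of 0] by (metis times_minplus.simps(2))
  have "C = C'" if C: "Q C" and C': "Q C'" for C C'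
  proof -
    from C C' obtain a a' where a: "\<forall>x. poly P x = a * (\<Prod>c\<in>#C. x + c)"
      and a': "\<forall>x. poly P x = a' * (\<Prod>c\<in>#C'. x + c)"
      by (auto simp: Q_def)
    show ?thesis
      by (rule corner_multiset_unique[OF _ fin[OF a] fin[OF a']]) (use C C' a a' in \<open>auto simp: Q_def\<close>)
  qed
  ultimately have "Q (corners P)"
    unfolding corners_def Q_def[symmetric] by (metis theI')
  then obtain a where "size (corners P) = degree P" "\<forall>x. poly P x = a * (\<Prod>c\<in>#corners P. x + c)"
    by (auto simp: Q_def)
  then show ?thesis
    using fin[of a "corners P"] that by (cases a) auto
qed

text \<open>The sign \<open>s\<close> treats the left and right slopes at \<open>x\<close> simultaneously.\<close>

lemma poly_minplus_one_sided:
  fixes P :: "minplus poly"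
  assumes w: "poly P (Fin x) = Fin w"
    and m: "coeff P m * Fin (real m * x) = Fin w"
    and extremal: "\<And>k. coeff P k * Fin (real k * x) = Fin w \<Longrightarrow> s * real m \<le> s * real k"
  shows "\<forall>\<^sub>F h in at_right 0. poly P (Fin (x + s * h)) = Fin (w + s * h * real m)"
proof -
  have lower: "\<forall>\<^sub>F h in at_right 0. \<forall>k\<in>{..degree P}.
      Fin (w + s * h * real m) \<le> coeff P k * Fin (real k * (x + s * h))"
  proof (rule eventually_ball_finite; intro ballI finite_atMost)
    fix k assume "k \<in> {..degree P}"
    show "\<forall>\<^sub>F h in at_right 0. Fin (w + s * h * real m) \<le> coeff P k * Fin (real k * (x + s * h))"
    proof (cases "coeff P k")
      case (Fin r)
      have "Fin w \<le> coeff P k * Fin (real k * x)"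
        unfolding w[symmetric] minplus_poly_eq_sum
        by (rule sum_minplus_le) (use \<open>k \<in> _\<close> in auto)
      \<comment> \<open>Monomials attaining the minimum at \<open>x\<close> are compared by slope.
        The others have a positive gap, which absorbs any difference of slopes for small
        \<open>h\<close>.\<close>
      then consider "r + real k * x = w" | "0 < r + real k * x - w"
        by (fastforce simp: Fin)
      then show ?thesis
      proof cases
        case 1
        then have s: "s * real m \<le> s * real k"
          using extremal[of k] Fin by simp
        have "\<forall>\<^sub>F h::real in at_right 0. h > 0"
          by (rule eventually_at_right_less)
        then show ?thesis
        proof eventually_elim
          case (elim h)
          have "h * (s * real m) \<le> h * (s * real k)"
            by (rule mult_left_mono[OF s]) (use elim in simp)
          moreover have "r + real k * (x + s * h) = w + h * (s * real k)"
            using 1 by (simp add: algebra_simps)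
          moreover have "w + s * h * real m = w + h * (s * real m)"
            by simp
          ultimately show ?case
            by (simp only: Fin times_minplus.simps less_eq_minplus.simps)
        qed
      next
        case 2
        then have "\<forall>\<^sub>F h in at_right 0. h * (s * real m - s * real k) \<le> r + real k * x - w"
          by (rule eventually_at_right_0_le)
        then show ?thesis
          by eventually_elim (simp add: Fin algebra_simps)
      qed
    qed simp
  qed
  have m_le: "m \<le> degree P"
    using m coeff_eq_0[of P m] by (force simp: zero_minplus_def)
  obtain r where r: "coeff P m = Fin r"
    using m by (cases "coeff P m") auto
  from lower show ?thesis
  proof eventually_elim
    case (elim h)
    have "poly P (Fin (x + s * h)) \<le> coeff P m * Fin (real m * (x + s * h))"
      unfolding minplus_poly_eq_sum by (rule sum_minplus_le) (use m_le in auto)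
    also have "\<dots> = Fin (w + s * h * real m)"
      using m by (auto simp: r algebra_simps)
    finally show ?case
      using elim by (intro antisym) (simp_all add: minplus_poly_eq_sum le_sum_minplus_iff)
  qed
qed

text \<open>Each one-sided slope is computed twice, from the extremal monomial attaining the minimum
  and from the factorization into corners.\<close>

lemma count_corners:
  fixes P :: "minplus poly"
  assumes w: "poly P (Fin x) = Fin w"
    and m: "coeff P m * Fin (real m * x) = Fin w"
    and M: "coeff P M * Fin (real M * x) = Fin w"
    and extremal: "\<And>k. coeff P k * Fin (real k * x) = Fin w \<Longrightarrow> m \<le> k \<and> k \<le> M"
  shows "count (corners P) (Fin x) = M - m"
    and "(\<Sum>c | c \<in># corners P \<and> c > Fin x. count (corners P) c) = m"
proof -
  have "P \<noteq> 0"
    using w by (auto simp: zero_minplus_def)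
  then obtain a where a: "\<And>y. poly P y = Fin a * (\<Prod>c\<in>#corners P. y + c)"
    using corners_factorization by metis
  have F: "poly P (Fin y) = Fin (a + corner_sum (corners P) y)" for y
    unfolding a corner_prod_eq by simp
  have pos: "\<forall>\<^sub>F h::real in at_right 0. h > 0"
    by (rule eventually_at_right_less)
  have "\<forall>\<^sub>F h in at_right 0. poly P (Fin (x + 1 * h)) = Fin (w + 1 * h * real m)"
    using extremal by (intro poly_minplus_one_sided w m) auto
  with corner_sum_right[of x "corners P"] pos
  have "\<forall>\<^sub>F h::real in at_right 0. size {#c \<in># corners P. c > Fin x#} = m"
    by eventually_elim (use w in \<open>auto simp: F\<close>)
  then have gt: "size {#c \<in># corners P. c > Fin x#} = m"
    by simp
  have "\<forall>\<^sub>F h in at_right 0. poly P (Fin (x + (-1) * h)) = Fin (w + (-1) * h * real M)"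
    using extremal by (intro poly_minplus_one_sided w M) auto
  with corner_sum_left[of x "corners P"] pos
  have "\<forall>\<^sub>F h::real in at_right 0. size {#c \<in># corners P. c \<ge> Fin x#} = M"
    by eventually_elim (use w in \<open>auto simp: F\<close>)
  then have ge: "size {#c \<in># corners P. c \<ge> Fin x#} = M"
    by simp
  show "count (corners P) (Fin x) = M - m"
    using gt ge by (simp add: size_filter_ge_eq)
  have "(\<Sum>c | c \<in># corners P \<and> c > Fin x. count (corners P) c) = size {#c \<in># corners P. c > Fin x#}"
    unfolding size_multiset_overloaded_eq by (rule sum.cong) auto
  then show "(\<Sum>c | c \<in># corners P \<and> c > Fin x. count (corners P) c) = m"
    using gt by simp
qed

section \<open>Continuity of the roots of a polynomial\<close>

lemma poly_eq_sum_atMost: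
  "degree p \<le> D \<Longrightarrow> poly p x = (\<Sum>i\<le>D. coeff p i * x ^ i)" for x :: "'a::comm_semiring_1"
  unfolding poly_altdef by (rule sum.mono_neutral_left) (auto simp: coeff_eq_0)

lemma coeff_limit_eq_0:
  fixes p :: "'e \<Rightarrow> complex poly"
  assumes "F \<noteq> bot" "\<And>k. ((\<lambda>e. coeff (p e) k) \<longlongrightarrow> coeff q k) F"
    "\<forall>\<^sub>F e in F. degree (p e) \<le> D" "D < k"
  shows "coeff q k = 0"
proof (rule tendsto_unique[OF assms(1) assms(2)])
  have "\<forall>\<^sub>F e in F. 0 = coeff (p e) k"
    using assms(3) by eventually_elim (use assms(4) in \<open>simp add: coeff_eq_0\<close>)
  then show "((\<lambda>e. coeff (p e) k) \<longlongrightarrow> 0) F"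
    by (rule Lim_transform_eventually[rotated]) simp
qed

lemma degree_limit_le:
  fixes p :: "'e \<Rightarrow> complex poly"
  assumes "F \<noteq> bot" "\<And>k. ((\<lambda>e. coeff (p e) k) \<longlongrightarrow> coeff q k) F"
    "\<forall>\<^sub>F e in F. degree (p e) \<le> D"
  shows "degree q \<le> D"
  using coeff_limit_eq_0[OF assms] by (intro degree_le) auto

lemma tendsto_poly_coeffs:
  fixes p :: "'e \<Rightarrow> complex poly"
  assumes "F \<noteq> bot" "\<And>k. ((\<lambda>e. coeff (p e) k) \<longlongrightarrow> coeff q k) F"
    "\<forall>\<^sub>F e in F. degree (p e) \<le> D"
  shows "((\<lambda>e. poly (p e) x) \<longlongrightarrow> poly q x) F"
proof -
  have "((\<lambda>e. \<Sum>i\<le>D. coeff (p e) i * x ^ i) \<longlongrightarrow> (\<Sum>i\<le>D. coeff q i * x ^ i)) F"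
    by (intro tendsto_intros assms)
  moreover have "\<forall>\<^sub>F e in F. (\<Sum>i\<le>D. coeff (p e) i * x ^ i) = poly (p e) x"
    using assms(3) by eventually_elim (simp add: poly_eq_sum_atMost)
  ultimately show ?thesis
    using poly_eq_sum_atMost[OF degree_limit_le[OF assms]] by (simp add: Lim_transform_eventually)
qed

text \<open>Compare factor by factor: if \<open>r\<close> is far from \<open>z\<close>, moving from
  \<open>z\<close> to \<open>y\<close> multiplies the distance to \<open>r\<close> by at most
  \<open>1 + dist y z / \<delta>\<close>. The leading coefficient occurs on both sides, so the bound
  remains useful when it tends to zero.\<close>

lemma cmod_poly_le_of_roots_far:
  fixes p :: "complex poly"
  assumes "\<delta> > 0" and far: "\<And>r. poly p r = 0 \<Longrightarrow> dist r z \<ge> \<delta>"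
  shows "cmod (poly p y) \<le> cmod (poly p z) * (1 + dist y z / \<delta>) ^ degree p"
proof (cases "p = 0")
  case False
  have *: "cmod (\<Prod>r\<in>#S. y - r) \<le> cmod (\<Prod>r\<in>#S. z - r) * (1 + dist y z / \<delta>) ^ size S"
    if "\<And>r. r \<in># S \<Longrightarrow> dist r z \<ge> \<delta>" for S
    using that
  proof (induction S)
    case (add r S)
    have "cmod (y - r) \<le> cmod (z - r) + dist y z"
      using norm_triangle_ineq[of "z - r" "y - z"] by (simp add: dist_norm)
    also have "dist y z \<le> cmod (z - r) * (dist y z / \<delta>)"
    proof -
      have "\<delta> * dist y z \<le> cmod (z - r) * dist y z"
        using add.prems[of r] by (intro mult_right_mono) (auto simp: dist_norm norm_minus_commute)
      then show ?thesis
        using \<open>\<delta> > 0\<close> by (simp add: field_simps)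
    qed
    finally have "cmod (y - r) \<le> cmod (z - r) * (1 + dist y z / \<delta>)"
      by (simp add: algebra_simps)
    moreover have "cmod (\<Prod>r\<in>#S. y - r) \<le> cmod (\<Prod>r\<in>#S. z - r) * (1 + dist y z / \<delta>) ^ size S"
      using add by auto
    ultimately have "cmod (y - r) * cmod (\<Prod>r\<in>#S. y - r) \<le>
        (cmod (z - r) * (1 + dist y z / \<delta>)) * (cmod (\<Prod>r\<in>#S. z - r) * (1 + dist y z / \<delta>) ^ size S)"
      using \<open>\<delta> > 0\<close> by (intro mult_mono) auto
    then show ?case
      by (simp add: norm_mult mult_ac)
  qed simp
  have p: "poly p x = lead_coeff p * (\<Prod>r\<in>#proots p. x - r)" for x
    by (subst complex_poly_decompose_multiset[of p, symmetric])
       (simp add: poly_prod_mset image_mset.compositionality o_def)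
  have "cmod (\<Prod>r\<in>#proots p. y - r) \<le> cmod (\<Prod>r\<in>#proots p. z - r) * (1 + dist y z / \<delta>) ^ size (proots p)"
    by (rule *) (use far False in auto)
  then have "cmod (lead_coeff p) * cmod (\<Prod>r\<in>#proots p. y - r) \<le>
      cmod (lead_coeff p) * (cmod (\<Prod>r\<in>#proots p. z - r) * (1 + dist y z / \<delta>) ^ size (proots p))"
    by (rule mult_left_mono) simp
  then show ?thesis
    by (simp add: p[of y] p[of z] norm_mult size_proots_complex mult.assoc)
qed simp

text \<open>Were all roots at distance at least \<open>\<delta>\<close> from \<open>z\<close>, the
  value at \<open>y\<close> would be at most \<open>K\<close> times the value at \<open>z\<close>.
  But the latter tends to zero and the former does not. Only the bound \<open>D\<close> on the
  degree enters \<open>K\<close>.\<close>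

lemma exists_root_near:
  fixes p :: "'e \<Rightarrow> complex poly"
  assumes "F \<noteq> bot" "\<And>k. ((\<lambda>e. coeff (p e) k) \<longlongrightarrow> coeff q k) F"
    "\<forall>\<^sub>F e in F. degree (p e) \<le> D" "q \<noteq> 0" "poly q z = 0" "\<delta> > 0"
  shows "\<forall>\<^sub>F e in F. \<exists>r. poly (p e) r = 0 \<and> dist r z < \<delta>"
proof -
  obtain y where y: "poly q y \<noteq> 0"
    using \<open>q \<noteq> 0\<close> poly_all_0_iff_0 by blast
  define K where "K = (1 + dist y z / \<delta>) ^ D"
  have "((\<lambda>e. cmod (poly (p e) y) - cmod (poly (p e) z) * K) \<longlongrightarrow> cmod (poly q y) - cmod (poly q z) * K) F"
    by (intro tendsto_intros tendsto_poly_coeffs[OF assms(1-3)])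
  then have "\<forall>\<^sub>F e in F. cmod (poly (p e) y) - cmod (poly (p e) z) * K > 0"
    by (rule order_tendstoD(1)) (use y assms(5) in simp)
  with assms(3) show ?thesis
  proof eventually_elim
    case (elim e)
    show ?case
    proof (rule ccontr)
      assume "\<nexists>r. poly (p e) r = 0 \<and> dist r z < \<delta>"
      then have "cmod (poly (p e) y) \<le> cmod (poly (p e) z) * (1 + dist y z / \<delta>) ^ degree (p e)"
        using \<open>\<delta> > 0\<close> by (intro cmod_poly_le_of_roots_far) (auto simp: not_less)
      also have "\<dots> \<le> cmod (poly (p e) z) * K"
        unfolding K_def using elim \<open>\<delta> > 0\<close> by (intro mult_left_mono power_increasing) auto
      finally show False
        using elim by simp
    qed
  qed
qed

lemma eventually_poly_neq_0:
  fixes p :: "'e \<Rightarrow> complex poly"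
  assumes "\<And>k. ((\<lambda>e. coeff (p e) k) \<longlongrightarrow> coeff q k) F" "q \<noteq> 0"
  shows "\<forall>\<^sub>F e in F. p e \<noteq> 0"
proof -
  have "\<forall>\<^sub>F e in F. coeff (p e) (degree q) \<noteq> 0"
    by (rule tendsto_imp_eventually_ne[OF assms(1)]) (use assms(2) in simp)
  then show ?thesis
    by eventually_elim auto
qed

text \<open>Choosing a root nearest to \<open>z\<close> gives a single function \<open>r\<close>
  that serves all \<open>\<delta>\<close> at once. The choice is meaningful since a nonzero
  polynomial has finitely many roots.\<close>

lemma exists_root_tendsto:
  fixes p :: "'e \<Rightarrow> complex poly"
  assumes "F \<noteq> bot" "\<And>k. ((\<lambda>e. coeff (p e) k) \<longlongrightarrow> coeff q k) F"
    "\<forall>\<^sub>F e in F. degree (p e) \<le> D" "q \<noteq> 0" "poly q z = 0"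
  obtains r where "\<forall>\<^sub>F e in F. poly (p e) (r e) = 0" "(r \<longlongrightarrow> z) F"
proof -
  define r where "r e = arg_min (\<lambda>r. dist r z) (\<lambda>r. poly (p e) r = 0)" for e
  have r: "poly (p e) (r e) = 0 \<and> dist (r e) z \<le> dist r' z" if "p e \<noteq> 0" "poly (p e) r' = 0" for e r'
  proof -
    let ?S = "{r. poly (p e) r = 0}"
    have S: "finite ?S" "?S \<noteq> {}"
      using poly_roots_finite that by auto
    have "is_arg_min (\<lambda>r. dist r z) (\<lambda>r. r \<in> ?S) (arg_min_on (\<lambda>r. dist r z) ?S)"
      using S by (metis arg_min_if_finite(1) arg_min_if_finite(2) is_arg_min_def)
    then have "is_arg_min (\<lambda>r. dist r z) (\<lambda>r. poly (p e) r = 0) (r e)"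
      by (simp add: arg_min_on_def r_def)
    then show ?thesis
      using that(2) by (auto simp: is_arg_min_linorder)
  qed
  have near: "\<forall>\<^sub>F e in F. poly (p e) (r e) = 0 \<and> dist (r e) z < \<delta>" if "\<delta> > 0" for \<delta>
    using exists_root_near[OF assms that] eventually_poly_neq_0[OF assms(2,4)]
    by eventually_elim (use r in fastforce)
  show ?thesis
  proof
    show "\<forall>\<^sub>F e in F. poly (p e) (r e) = 0"
      using near[of 1] by (auto elim: eventually_mono)
    show "(r \<longlongrightarrow> z) F"
    proof (rule tendstoI)
      fix \<delta> :: real assume "\<delta> > 0"
      then show "\<forall>\<^sub>F e in F. dist (r e) z < \<delta>"
        using near[of \<delta>] by (auto elim: eventually_mono)
    qed
  qed
qed

text \<open>Synthetic division from the top: by \<open>rec\<close> a coefficient of the quotient is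
  determined by the next higher one and the dividend. The induction starts at \<open>k > D\<close>,
  where both sides vanish.\<close>

lemma tendsto_coeff_deflate:
  fixes s :: "'e \<Rightarrow> complex poly"
  assumes "F \<noteq> bot" and deg: "\<forall>\<^sub>F e in F. degree (s e) \<le> D" "degree t \<le> D"
    and lim: "\<And>k. ((\<lambda>e. coeff ([:- r e, 1:] * s e) k) \<longlongrightarrow> coeff ([:- z, 1:] * t) k) F"
    and r: "(r \<longlongrightarrow> z) F"
  shows "((\<lambda>e. coeff (s e) k) \<longlongrightarrow> coeff t k) F"
proof (induction "Suc D - k" arbitrary: k)
  case 0
  then have "\<forall>\<^sub>F e in F. coeff t k = coeff (s e) k"
    using deg by (auto elim!: eventually_mono simp: coeff_eq_0)
  then show ?case
    by (rule Lim_transform_eventually[rotated]) simp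
next
  case (Suc m)
  have rec: "coeff u k = coeff ([:- c, 1:] * u) (Suc k) + c * coeff u (Suc k)" for c :: complex and u
    by simp
  have "((\<lambda>e. coeff (s e) (Suc k)) \<longlongrightarrow> coeff t (Suc k)) F"
    using Suc by (intro Suc.hyps(1)) simp
  then have "((\<lambda>e. coeff ([:- r e, 1:] * s e) (Suc k) + r e * coeff (s e) (Suc k)) \<longlongrightarrow>
      coeff ([:- z, 1:] * t) (Suc k) + z * coeff t (Suc k)) F"
    by (intro tendsto_add tendsto_mult lim r)
  then show ?case
    by (simp only: rec[symmetric])
qed

text \<open>At a root of modulus at most \<open>R\<close> the constant coefficient is balanced by
  the higher ones; these tend to zero while it does not. This is how a drop of degree in the limit
  shows in the roots.\<close>

lemma roots_escape:
  fixes p :: "'e \<Rightarrow> complex poly"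
  assumes "F \<noteq> bot" and lim: "\<And>k. ((\<lambda>e. coeff (p e) k) \<longlongrightarrow> coeff q k) F"
    and deg: "\<forall>\<^sub>F e in F. degree (p e) \<le> D" and "q \<noteq> 0" "degree q = 0"
  shows "\<forall>\<^sub>F e in F. \<forall>\<mu>\<in>#proots (p e). cmod \<mu> > R"
proof -
  have q0: "coeff q 0 \<noteq> 0"
    using assms(4,5) by (metis leading_coeff_0_iff)
  have "((\<lambda>e. cmod (coeff (p e) 0) - (\<Sum>i\<in>{1..D}. cmod (coeff (p e) i) * \<bar>R\<bar> ^ i)) \<longlongrightarrow>
      cmod (coeff q 0) - (\<Sum>i\<in>{1..D}. cmod (coeff q i) * \<bar>R\<bar> ^ i)) F"
    by (intro tendsto_intros lim)
  also have "(\<Sum>i\<in>{1..D}. cmod (coeff q i) * \<bar>R\<bar> ^ i) = 0"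
    by (rule sum.neutral) (use assms(5) in \<open>auto simp: coeff_eq_0\<close>)
  finally have "\<forall>\<^sub>F e in F. cmod (coeff (p e) 0) - (\<Sum>i\<in>{1..D}. cmod (coeff (p e) i) * \<bar>R\<bar> ^ i) > 0"
    by (rule order_tendstoD(1)) (use q0 in simp)
  with deg eventually_poly_neq_0[OF lim assms(4)] show ?thesis
  proof eventually_elim
    case (elim e)
    show ?case
    proof (intro ballI, rule ccontr)
      fix \<mu> assume "\<mu> \<in># proots (p e)" and "\<not> cmod \<mu> > R"
      then have \<mu>: "poly (p e) \<mu> = 0" "cmod \<mu> \<le> \<bar>R\<bar>"
        using elim(2) by auto
      have "{..D} = insert 0 {1..D}" by auto
      then have "coeff (p e) 0 = - (\<Sum>i\<in>{1..D}. coeff (p e) i * \<mu> ^ i)"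
        using \<mu>(1) poly_eq_sum_atMost[OF elim(1), of \<mu>] by (simp add: eq_neg_iff_add_eq_0)
      then have "cmod (coeff (p e) 0) \<le> (\<Sum>i\<in>{1..D}. cmod (coeff (p e) i) * cmod \<mu> ^ i)"
        using norm_sum[of "\<lambda>i. coeff (p e) i * \<mu> ^ i" "{1..D}"] by (simp add: norm_mult norm_power)
      also have "\<dots> \<le> (\<Sum>i\<in>{1..D}. cmod (coeff (p e) i) * \<bar>R\<bar> ^ i)"
        using \<mu>(2) by (intro sum_mono mult_left_mono power_mono) auto
      finally show False
        using elim(3) by simp
    qed
  qed
qed

text \<open>Dividing \<open>p e\<close> and \<open>q\<close> by their matched linear factors at the
  same time takes care of multiplicities: a repeated root of the limit is found again in the
  quotient. Once the limit is a nonzero constant, all remaining roots escape and form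
  \<open>W\<close>.\<close>

theorem roots_tendsto:
  fixes p :: "'e \<Rightarrow> complex poly"
  assumes "F \<noteq> bot" "\<And>k. ((\<lambda>e. coeff (p e) k) \<longlongrightarrow> coeff q k) F"
    "\<forall>\<^sub>F e in F. degree (p e) \<le> D" "q \<noteq> 0" "proots q = mset zs"
  shows "\<exists>L W. (\<forall>\<^sub>F e in F. p e \<noteq> 0 \<and> proots (p e) = mset (map (\<lambda>i. L i e) [0..<length zs]) + W e) \<and>
    (\<forall>i<length zs. (L i \<longlongrightarrow> zs ! i) F) \<and>
    (\<forall>R. \<forall>\<^sub>F e in F. \<forall>\<mu>\<in>#W e. cmod \<mu> > R)"
  using assms(2-5)
proof (induction zs arbitrary: p q)
  case Nil
  have "degree q = 0"
    using Nil.prems(4) size_proots_complex[of q] by simp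
  then have "\<forall>\<^sub>F e in F. \<forall>\<mu>\<in>#proots (p e). cmod \<mu> > R" for R
    by (intro roots_escape[OF \<open>F \<noteq> bot\<close> Nil.prems(1-3)])
  then show ?case
    using eventually_poly_neq_0[OF Nil.prems(1,3)]
    by (intro exI[of _ "\<lambda>_ _. 0"] exI[of _ "\<lambda>e. proots (p e)"]) auto
next
  case (Cons z zs)
  have "z \<in># proots q"
    using Cons.prems(4) by simp
  then have z: "poly q z = 0"
    using Cons.prems(3) by simp
  obtain r where r: "\<forall>\<^sub>F e in F. poly (p e) (r e) = 0" "(r \<longlongrightarrow> z) F"
    using exists_root_tendsto[OF \<open>F \<noteq> bot\<close> Cons.prems(1-3) z] .
  define s where "s e = p e div [:- r e, 1:]" for e
  define t where "t = q div [:- z, 1:]"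
  have s: "p e = [:- r e, 1:] * s e" if "poly (p e) (r e) = 0" for e
    using that unfolding s_def by (metis dvd_mult_div_cancel poly_eq_0_iff_dvd)
  have t: "q = [:- z, 1:] * t"
    using z unfolding t_def by (metis dvd_mult_div_cancel poly_eq_0_iff_dvd)
  have factor: "u \<noteq> 0 \<and> degree u \<le> degree v \<and> proots v = add_mset c (proots u)"
    if "v \<noteq> 0" "v = [:- c, 1:] * u" for u v :: "complex poly" and c
    using that by (auto simp: degree_mult_eq proots_mult simp del: mult_pCons_left)
  have t': "t \<noteq> 0" "degree t \<le> degree q" "proots q = add_mset z (proots t)"
    using factor[OF Cons.prems(3) t] by auto
  have pe: "\<forall>\<^sub>F e in F. p e \<noteq> 0 \<and> p e = [:- r e, 1:] * s e \<and> degree (s e) \<le> D \<and>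
      proots (p e) = add_mset (r e) (proots (s e))"
    using r(1) eventually_poly_neq_0[OF Cons.prems(1,3)] Cons.prems(2)
    by eventually_elim (use factor s in fastforce)
  have "\<exists>L W. (\<forall>\<^sub>F e in F. s e \<noteq> 0 \<and> proots (s e) = mset (map (\<lambda>i. L i e) [0..<length zs]) + W e) \<and>
    (\<forall>i<length zs. (L i \<longlongrightarrow> zs ! i) F) \<and>
    (\<forall>R. \<forall>\<^sub>F e in F. \<forall>\<mu>\<in>#W e. cmod \<mu> > R)"
  proof (rule Cons.IH)
    show deg: "\<forall>\<^sub>F e in F. degree (s e) \<le> D"
      using pe by eventually_elim auto
    show "t \<noteq> 0" by (rule t')
    show "proots t = mset zs"
      using t'(3) Cons.prems(4) by simp
    have "degree t \<le> D"
      using t'(2) degree_limit_le[OF \<open>F \<noteq> bot\<close> Cons.prems(1,2)] by simp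
    moreover have "((\<lambda>e. coeff ([:- r e, 1:] * s e) k) \<longlongrightarrow> coeff ([:- z, 1:] * t) k) F" for k
    proof (rule Lim_transform_eventually)
      show "((\<lambda>e. coeff (p e) k) \<longlongrightarrow> coeff ([:- z, 1:] * t) k) F"
        using Cons.prems(1) t by simp
      show "\<forall>\<^sub>F e in F. coeff (p e) k = coeff ([:- r e, 1:] * s e) k"
        using pe by eventually_elim metis
    qed
    ultimately show "((\<lambda>e. coeff (s e) k) \<longlongrightarrow> coeff t k) F" for k
      by (rule tendsto_coeff_deflate[OF \<open>F \<noteq> bot\<close> deg _ _ r(2)])
  qed
  then obtain L W where LW: "\<forall>\<^sub>F e in F. s e \<noteq> 0 \<and> proots (s e) = mset (map (\<lambda>i. L i e) [0..<length zs]) + W e"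
    "\<And>i. i < length zs \<Longrightarrow> (L i \<longlongrightarrow> zs ! i) F" "\<And>R. \<forall>\<^sub>F e in F. \<forall>\<mu>\<in>#W e. cmod \<mu> > R"
    by blast
  have pe': "\<forall>\<^sub>F e in F. p e \<noteq> 0 \<and> proots (p e) = add_mset (r e) (proots (s e))"
    by (rule eventually_mono[OF pe]) blast
  define L' where "L' i = (case i of 0 \<Rightarrow> r | Suc i \<Rightarrow> L i)" for i
  have L': "map (\<lambda>i. L' i e) [0..<length (z # zs)] = r e # map (\<lambda>i. L i e) [0..<length zs]" for e
    by (simp add: L'_def map_upt_Suc del: upt_Suc)
  have "\<forall>\<^sub>F e in F. p e \<noteq> 0 \<and> proots (p e) = mset (map (\<lambda>i. L' i e) [0..<length (z # zs)]) + W e"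
    using pe' LW(1) unfolding L' by eventually_elim simp
  moreover have "(L' i \<longlongrightarrow> (z # zs) ! i) F" if "i < length (z # zs)" for i
    using that LW(2) r(2) by (cases i) (auto simp: L'_def)
  ultimately show ?case
    using LW(3) by blast
qed

section \<open>Expansion of permanents and determinants of pencils\<close>

text \<open>Index set for expanding a product over the rows of a pencil: row \<open>i\<close>
  contributes its coefficient of level \<open>\<kappa> i\<close>, and the levels add up to the
  exponent of the indeterminate.\<close>

definition level_choices :: "nat \<Rightarrow> nat \<Rightarrow> ('n::finite \<Rightarrow> nat) set" where
  "level_choices d n = {\<kappa>. (\<forall>i. \<kappa> i \<le> d) \<and> (\<Sum>i\<in>UNIV. \<kappa> i) = n}"

lemma finite_bounded_choices: "finite {\<kappa> :: 'n::finite \<Rightarrow> nat. \<forall>i. \<kappa> i \<le> d}"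
proof -
  have "finite (PiE (UNIV :: 'n set) (\<lambda>_. {..d}))"
    by (intro finite_PiE) auto
  then show ?thesis
    by (simp add: PiE_UNIV_domain Pi_def)
qed

lemma finite_level_choices [simp]: "finite (level_choices d n)"
  by (rule finite_subset[OF _ finite_bounded_choices]) (auto simp: level_choices_def)

lemma prod_monom: "(\<Prod>i\<in>S. monom (f i) (g i)) = monom (\<Prod>i\<in>S. f i) (\<Sum>i\<in>S. g i)"
  by (induction S rule: infinite_finite_induct) (auto simp: mult_monom)

text \<open>Valid over any commutative semiring, so that the min-plus permanent and the complex
  determinant are expanded over the same terms.\<close>

lemma coeff_prod_pencil:
  fixes B :: "nat \<Rightarrow> 'a::comm_semiring_1 ^ 'n ^ 'n"
  shows "coeff (\<Prod>i\<in>UNIV. pencil d B $ i $ \<sigma> i) n =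
    (\<Sum>\<kappa>\<in>level_choices d n. \<Prod>i\<in>UNIV. B (\<kappa> i) $ i $ \<sigma> i)"
proof -
  have "(\<Prod>i\<in>UNIV. pencil d B $ i $ \<sigma> i) =
      (\<Sum>\<kappa>\<in>PiE UNIV (\<lambda>_. {..d}). \<Prod>i\<in>UNIV. monom (B (\<kappa> i) $ i $ \<sigma> i) (\<kappa> i))"
    unfolding pencil_def by (simp, subst prod_sum_PiE) auto
  also have "\<dots> = (\<Sum>\<kappa> | \<forall>i. \<kappa> i \<le> d. monom (\<Prod>i\<in>UNIV. B (\<kappa> i) $ i $ \<sigma> i) (\<Sum>i\<in>UNIV. \<kappa> i))"
    by (simp add: PiE_UNIV_domain Pi_def prod_monom)
  finally have "coeff (\<Prod>i\<in>UNIV. pencil d B $ i $ \<sigma> i) n =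
      (\<Sum>\<kappa> | \<forall>i. \<kappa> i \<le> d. if (\<Sum>i\<in>UNIV. \<kappa> i) = n then \<Prod>i\<in>UNIV. B (\<kappa> i) $ i $ \<sigma> i else 0)"
    by (simp add: coeff_sum)
  also have "\<dots> = (\<Sum>\<kappa>\<in>level_choices d n. \<Prod>i\<in>UNIV. B (\<kappa> i) $ i $ \<sigma> i)"
    unfolding level_choices_def
    by (rule sum.mono_neutral_cong_right) (auto simp: finite_bounded_choices)
  finally show ?thesis .
qed

lemma coeff_perm_pencil:
  fixes B :: "nat \<Rightarrow> 'a::comm_semiring_1 ^ 'n ^ 'n"
  shows "coeff (perm (pencil d B)) n =
    (\<Sum>\<sigma> | \<sigma> permutes UNIV. \<Sum>\<kappa>\<in>level_choices d n. \<Prod>i\<in>UNIV. B (\<kappa> i) $ i $ \<sigma> i)"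
  by (simp add: perm_def perm_weight_def coeff_sum coeff_prod_pencil)

lemma coeff_of_int_mult: "coeff (of_int m * p) n = of_int m * coeff p n" for p :: "'a::comm_ring_1 poly"
  by (simp add: of_int_poly)

lemma coeff_det_pencil:
  fixes B :: "nat \<Rightarrow> 'a::comm_ring_1 ^ 'n ^ 'n"
  shows "coeff (det (pencil d B)) n =
    (\<Sum>\<sigma> | \<sigma> permutes UNIV. of_int (sign \<sigma>) *
      (\<Sum>\<kappa>\<in>level_choices d n. \<Prod>i\<in>UNIV. B (\<kappa> i) $ i $ \<sigma> i))"
  by (simp add: det_def coeff_sum coeff_of_int_mult coeff_prod_pencil)

lemma degree_det_pencil_le:
  fixes B :: "nat \<Rightarrow> 'a::comm_ring_1 ^ 'n ^ 'n"
  shows "degree (det (pencil d B)) \<le> CARD('n) * d"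
proof (rule degree_le, intro allI impI)
  fix n assume n: "CARD('n) * d < n"
  have "level_choices d n = ({} :: ('n \<Rightarrow> nat) set)"
  proof -
    have "(\<Sum>i\<in>UNIV. \<kappa> i) \<le> CARD('n) * d" if "\<forall>i. \<kappa> i \<le> d" for \<kappa> :: "'n \<Rightarrow> nat"
      using sum_bounded_above[of UNIV \<kappa> d] that by simp
    then show ?thesis
      using n by (auto simp: level_choices_def not_less[symmetric])
  qed
  then show "coeff (det (pencil d B)) n = 0"
    by (simp add: coeff_det_pencil)
qed

text \<open>Every term contains each row factor once, each column factor once after reordering by
  the permutation, and powers of \<open>x\<close> whose exponents add up to \<open>n\<close>. The
  powers of \<open>x\<close> express the substitution of \<open>x Y\<close> for the
  indeterminate.\<close>

lemma coeff_det_pencil_scaled: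
  fixes B :: "nat \<Rightarrow> 'a::comm_ring_1 ^ 'n ^ 'n"
  shows "coeff (det (pencil d (\<lambda>k. \<chi> i j. x ^ k * u i * v j * B k $ i $ j))) n =
    (\<Prod>i\<in>UNIV. u i) * (\<Prod>j\<in>UNIV. v j) * x ^ n * coeff (det (pencil d B)) n"
proof -
  have *: "(\<Prod>i\<in>UNIV. x ^ \<kappa> i * u i * v (\<sigma> i) * B (\<kappa> i) $ i $ \<sigma> i) =
      (\<Prod>i\<in>UNIV. u i) * (\<Prod>j\<in>UNIV. v j) * x ^ n * (\<Prod>i\<in>UNIV. B (\<kappa> i) $ i $ \<sigma> i)"
    if "\<sigma> permutes UNIV" "\<kappa> \<in> level_choices d n" for \<sigma> :: "'n \<Rightarrow> 'n" and \<kappa> :: "'n \<Rightarrow> nat"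
  proof -
    have "(\<Prod>i\<in>UNIV. v (\<sigma> i)) = (\<Prod>j\<in>UNIV. v j)"
      using prod.permute[OF that(1), of v] by (simp add: o_def)
    moreover have "(\<Prod>i\<in>UNIV. x ^ \<kappa> i) = x ^ n"
      using that(2) by (auto simp: level_choices_def power_sum)
    ultimately show ?thesis
      by (simp add: prod.distrib mult_ac)
  qed
  have "(\<Sum>\<kappa>\<in>level_choices d n. \<Prod>i\<in>UNIV. x ^ \<kappa> i * u i * v (\<sigma> i) * B (\<kappa> i) $ i $ \<sigma> i) =
      (\<Prod>i\<in>UNIV. u i) * (\<Prod>j\<in>UNIV. v j) * x ^ n *
      (\<Sum>\<kappa>\<in>level_choices d n. \<Prod>i\<in>UNIV. B (\<kappa> i) $ i $ \<sigma> i)"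
    if "\<sigma> permutes UNIV" for \<sigma> :: "'n \<Rightarrow> 'n"
    unfolding sum_distrib_left by (intro sum.cong refl *[OF that])
  then have "(\<Sum>\<sigma> | \<sigma> permutes UNIV. of_int (sign \<sigma>) * (\<Sum>\<kappa>\<in>level_choices d n.
        \<Prod>i\<in>UNIV. x ^ \<kappa> i * u i * v (\<sigma> i) * B (\<kappa> i) $ i $ \<sigma> i)) =
      (\<Sum>\<sigma> | \<sigma> permutes UNIV. of_int (sign \<sigma>) * ((\<Prod>i\<in>UNIV. u i) * (\<Prod>j\<in>UNIV. v j) * x ^ n *
        (\<Sum>\<kappa>\<in>level_choices d n. \<Prod>i\<in>UNIV. B (\<kappa> i) $ i $ \<sigma> i)))"
    by (intro sum.cong refl) simp
  also have "\<dots> = (\<Prod>i\<in>UNIV. u i) * (\<Prod>j\<in>UNIV. v j) * x ^ n * coeff (det (pencil d B)) n"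
    by (simp add: coeff_det_pencil sum_distrib_left mult_ac)
  finally show ?thesis
    by (simp add: coeff_det_pencil)
qed

lemma tendsto_coeff_det_pencil:
  fixes B :: "'e \<Rightarrow> nat \<Rightarrow> complex ^ 'n ^ 'n"
  assumes "\<And>k i j. k \<le> d \<Longrightarrow> ((\<lambda>e. B e k $ i $ j) \<longlongrightarrow> b k $ i $ j) F"
  shows "((\<lambda>e. coeff (det (pencil d (B e))) n) \<longlongrightarrow> coeff (det (pencil d b)) n) F"
  unfolding coeff_det_pencil
  by (intro tendsto_sum tendsto_mult tendsto_const tendsto_prod assms) (auto simp: level_choices_def)

section \<open>The arcs of the auxiliary pencil\<close>

lemma eval_pencil_entry:
  "eval_matrix (pencil d A) (Fin x) $ i $ j = (\<Sum>k\<le>d. A k $ i $ j * Fin (real k * x))"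
  by (simp add: eval_matrix_def pencil_def poly_sum poly_monom Fin_power)

lemma eval_pencil_entry_le:
  "k \<le> d \<Longrightarrow> eval_matrix (pencil d A) (Fin x) $ i $ j \<le> A k $ i $ j * Fin (real k * x)"
  unfolding eval_pencil_entry by (rule sum_minplus_le) auto

lemma poly_perm: "poly (perm M) x = perm (eval_matrix M x)"
  by (simp add: perm_def perm_weight_def poly_sum poly_prod eval_matrix_def)

lemma hungarian_pair_weight:
  assumes "hungarian_pair B U V" "\<sigma> permutes UNIV"
  shows "perm B = (\<Prod>i\<in>UNIV. Fin (U $ i + V $ \<sigma> i))"
  using assms sum.permute[OF assms(2), of "\<lambda>j. V $ j"]
  by (simp add: hungarian_pair_def prod_Fin sum.distrib o_def)

text \<open>Complementary slackness: along any permutation the dual values add up to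
  \<open>perm B\<close>, so the excess of its weight is the sum of the slacks of its arcs.\<close>

lemma optimal_iff_saturated:
  assumes H: "hungarian_pair B U V" and \<sigma>: "\<sigma> permutes UNIV"
  shows "perm_weight B \<sigma> = perm B \<longleftrightarrow> (\<forall>i. (i, \<sigma> i) \<in> Sat B U V)"
proof
  assume *: "perm_weight B \<sigma> = perm B"
  have "Fin (U $ i + V $ \<sigma> i) = B $ i $ \<sigma> i" for i
  proof (rule prod_minplus_mono_eq[where S = UNIV and f = "\<lambda>i. Fin (U $ i + V $ \<sigma> i)" and g = "\<lambda>i. B $ i $ \<sigma> i"])
    show "Fin (U $ i + V $ \<sigma> i) \<le> B $ i $ \<sigma> i" for i
      using H by (simp add: hungarian_pair_def)
    show "(\<Prod>i\<in>UNIV. B $ i $ \<sigma> i) \<le> (\<Prod>i\<in>UNIV. Fin (U $ i + V $ \<sigma> i))"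
      using * hungarian_pair_weight[OF H \<sigma>] by (simp add: perm_weight_def)
  qed (auto simp: prod_Fin)
  then show "\<forall>i. (i, \<sigma> i) \<in> Sat B U V"
    by (simp add: Sat_def)
next
  assume "\<forall>i. (i, \<sigma> i) \<in> Sat B U V"
  then show "perm_weight B \<sigma> = perm B"
    using hungarian_pair_weight[OF H \<sigma>] by (simp add: Sat_def perm_weight_def)
qed

lemma Opt_subset_Sat: "hungarian_pair B U V \<Longrightarrow> Opt B \<subseteq> Sat B U V"
  using optimal_iff_saturated by (fastforce simp: Opt_def)

text \<open>The graph may be chosen separately for each level. The pair is demanded even if every
  level uses \<open>Opt_level\<close>, because the determinant is scaled by it.\<close>

definition admissible_arcs ::
  "nat \<Rightarrow> (nat \<Rightarrow> minplus ^ 'n ^ 'n) \<Rightarrow> real \<Rightarrow> real ^ 'n \<Rightarrow> real ^ 'n \<Rightarrow> (nat \<Rightarrow> ('n \<times> 'n) set) \<Rightarrow> bool" where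
  "admissible_arcs d A \<gamma> U V G \<longleftrightarrow> hungarian_pair (eval_matrix (pencil d A) (Fin \<gamma>)) U V \<and>
     (\<forall>k\<le>d. G k = Opt_level d A \<gamma> k \<or> G k = Sat_level d A \<gamma> U V k)"

text \<open>The right-hand side does not mention \<open>G\<close>, so all admissible families give the same determinant.\<close>

lemma all_arcs_iff:
  assumes adm: "admissible_arcs d A \<gamma> U V G" and \<sigma>: "\<sigma> permutes UNIV" and \<kappa>: "\<And>i. \<kappa> i \<le> d"
  shows "(\<forall>i. (i, \<sigma> i) \<in> G (\<kappa> i)) \<longleftrightarrow>
    (\<Prod>i\<in>UNIV. A (\<kappa> i) $ i $ \<sigma> i * Fin (real (\<kappa> i) * \<gamma>)) = perm (eval_matrix (pencil d A) (Fin \<gamma>))"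
    (is "?L \<longleftrightarrow> ?R")
proof -
  define B where "B = eval_matrix (pencil d A) (Fin \<gamma>)"
  have H: "hungarian_pair B U V"
    using adm by (simp add: admissible_arcs_def B_def)
  have G: "G (\<kappa> i) = Opt B \<inter> tight_arcs d A \<gamma> (\<kappa> i) \<or> G (\<kappa> i) = Sat B U V \<inter> tight_arcs d A \<gamma> (\<kappa> i)" for i
    using adm \<kappa>[of i] by (auto simp: admissible_arcs_def Opt_level_def Sat_level_def B_def)
  have fin: "perm B \<noteq> Infty"
    using H by (metis hungarian_pair_def minplus.distinct(1))
  show ?thesis
  proof
    assume ?L
    then have sat: "(i, \<sigma> i) \<in> Sat B U V" and tight: "(i, \<sigma> i) \<in> tight_arcs d A \<gamma> (\<kappa> i)" for i
      using G[of i] Opt_subset_Sat[OF H] by auto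
    then have "perm_weight B \<sigma> = perm B"
      using optimal_iff_saturated[OF H \<sigma>] by simp
    moreover have "A (\<kappa> i) $ i $ \<sigma> i * Fin (real (\<kappa> i) * \<gamma>) = B $ i $ \<sigma> i" for i
      using tight[of i] by (simp add: tight_arcs_def B_def)
    ultimately show ?R
      by (simp add: perm_weight_def B_def)
  next
    assume R: ?R
    \<comment> \<open>The weight of \<open>\<sigma>\<close> lies between \<open>perm B\<close> and
      the product over the chosen levels, and \<open>R\<close> closes the chain. Thus
      \<open>\<sigma>\<close> is optimal and each chosen level is tight; membership in the smaller
      graph \<open>Opt B\<close> then covers both alternatives.\<close>
    have le: "B $ i $ \<sigma> i \<le> A (\<kappa> i) $ i $ \<sigma> i * Fin (real (\<kappa> i) * \<gamma>)" for i
      unfolding B_def by (rule eval_pencil_entry_le[OF \<kappa>])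
    have "perm_weight B \<sigma> \<le> (\<Prod>i\<in>UNIV. A (\<kappa> i) $ i $ \<sigma> i * Fin (real (\<kappa> i) * \<gamma>))"
      unfolding perm_weight_def by (rule prod_minplus_mono) (rule le)
    then have "perm_weight B \<sigma> \<le> perm B"
      using R by (simp add: B_def)
    then have opt: "perm_weight B \<sigma> = perm B"
      using perm_le_perm_weight[OF \<sigma>] by (rule antisym)
    have "B $ i $ \<sigma> i = A (\<kappa> i) $ i $ \<sigma> i * Fin (real (\<kappa> i) * \<gamma>)" for i
      by (rule prod_minplus_mono_eq[where S = UNIV and f = "\<lambda>i. B $ i $ \<sigma> i"
            and g = "\<lambda>i. A (\<kappa> i) $ i $ \<sigma> i * Fin (real (\<kappa> i) * \<gamma>)"])
        (use le R opt fin in \<open>simp_all add: perm_weight_def B_def\<close>)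
    then have "(i, \<sigma> i) \<in> tight_arcs d A \<gamma> (\<kappa> i)" for i
      by (simp add: tight_arcs_def B_def)
    moreover have "(i, \<sigma> i) \<in> Opt B" for i
      using opt \<sigma> by (auto simp: Opt_def)
    ultimately show ?L
      using G Opt_subset_Sat[OF H] by blast
  qed
qed

lemma coeff_det_aux_pencil:
  fixes b :: "nat \<Rightarrow> complex ^ 'n ^ 'n"
  assumes adm: "admissible_arcs d A \<gamma> U V G"
  shows "coeff (det (aux_pencil d b G)) n =
    (\<Sum>\<sigma> | \<sigma> permutes UNIV. of_int (sign \<sigma>) * (\<Sum>\<kappa>\<in>level_choices d n.
      if (\<Prod>i\<in>UNIV. A (\<kappa> i) $ i $ \<sigma> i * Fin (real (\<kappa> i) * \<gamma>)) = perm (eval_matrix (pencil d A) (Fin \<gamma>))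
      then \<Prod>i\<in>UNIV. b (\<kappa> i) $ i $ \<sigma> i else 0))"
proof -
  have eq: "(\<Prod>i\<in>UNIV. restrict_matrix (b (\<kappa> i)) (G (\<kappa> i)) $ i $ \<sigma> i) =
    (if (\<Prod>i\<in>UNIV. A (\<kappa> i) $ i $ \<sigma> i * Fin (real (\<kappa> i) * \<gamma>)) = perm (eval_matrix (pencil d A) (Fin \<gamma>))
      then \<Prod>i\<in>UNIV. b (\<kappa> i) $ i $ \<sigma> i else 0)"
    if "\<sigma> permutes UNIV" "\<kappa> \<in> level_choices d n" for \<sigma> :: "'n \<Rightarrow> 'n" and \<kappa>
  proof -
    have "\<And>i. \<kappa> i \<le> d"
      using that(2) by (auto simp: level_choices_def)
    from all_arcs_iff[of d A \<gamma> U V G \<sigma> \<kappa>, OF adm that(1) this]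
    have iff: "(\<Prod>i\<in>UNIV. A (\<kappa> i) $ i $ \<sigma> i * Fin (real (\<kappa> i) * \<gamma>)) = perm (eval_matrix (pencil d A) (Fin \<gamma>)) \<longleftrightarrow>
        (\<forall>i. (i, \<sigma> i) \<in> G (\<kappa> i))"
      by simp
    show ?thesis
    proof (cases "\<forall>i. (i, \<sigma> i) \<in> G (\<kappa> i)")
      case False
      then have "(\<Prod>i\<in>UNIV. restrict_matrix (b (\<kappa> i)) (G (\<kappa> i)) $ i $ \<sigma> i) = 0"
        by (intro prod_zero) (auto simp: restrict_matrix_def)
      then show ?thesis
        unfolding iff if_not_P[OF False] .
    qed (simp add: iff restrict_matrix_def)
  qed
  show ?thesis
    unfolding aux_pencil_def coeff_det_pencil
    by (intro sum.cong refl arg_cong2[of _ _ _ _ "(*)"], rule eq) auto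
qed

lemma det_aux_pencil_eq_Sat:
  assumes "admissible_arcs d A \<gamma> U V G"
  shows "det (aux_pencil d b G) = det (aux_pencil d b (Sat_level d A \<gamma> U V))"
proof -
  have "admissible_arcs d A \<gamma> U V (Sat_level d A \<gamma> U V)"
    using assms by (simp add: admissible_arcs_def)
  then show ?thesis
    using assms by (intro poly_eqI) (simp add: coeff_det_aux_pencil)
qed

section \<open>Asymptotics of the scaled pencil\<close>

lemma proots_prod_mset_linear: "proots (\<Prod>r\<in>#S. [:- f r, 1:]) = image_mset f S"
  for f :: "'a \<Rightarrow> 'b::idom"
proof (induction S)
  case (add r S)
  have "(\<Prod>r\<in>#S. [:- f r, 1:]) \<noteq> 0"
    by (auto simp: prod_mset_zero_iff)
  then show ?case
    using add by (simp add: proots_mult del: mult_pCons_left)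
qed simp

text \<open>The hypothesis says that \<open>q\<close> at \<open>Y\<close> is \<open>c\<close> times
  \<open>p\<close> at \<open>x Y\<close>. Complete factorizations are compared instead of sets of
  roots, so multiplicities are kept.\<close>

lemma proots_scaled:
  fixes p q :: "complex poly"
  assumes "c \<noteq> 0" "x \<noteq> 0" "q \<noteq> 0" and coeff: "\<And>n. coeff q n = c * x ^ n * coeff p n"
  shows "p \<noteq> 0" "proots p = image_mset (\<lambda>r. x * r) (proots q)"
proof -
  show "p \<noteq> 0"
    using coeff \<open>q \<noteq> 0\<close> by (metis coeff_0 leading_coeff_0_iff mult_zero_right)
  have q: "q = smult c (pcompose p [:0, x:])"
    by (rule poly_eqI) (simp add: coeff coeff_pcompose_linear)
  \<comment> \<open>By the coefficient relation this is the leading coefficient of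
    \<open>p\<close>.\<close>
  define k where "k = lead_coeff q / (c * x ^ degree q)"
  have "poly p y = poly (smult k (\<Prod>r\<in>#proots q. [:- (x * r), 1:])) y" for y
  proof -
    have *: "(\<Prod>r\<in>#S. y / x - r) * x ^ size S = (\<Prod>r\<in>#S. y - x * r)" for S
    proof (induction S)
      case (add r S)
      have "(\<Prod>r\<in>#add_mset r S. y / x - r) * x ^ size (add_mset r S) =
          ((y / x - r) * x) * ((\<Prod>r\<in>#S. y / x - r) * x ^ size S)"
        by (simp add: mult_ac)
      also have "(y / x - r) * x = y - x * r"
        using \<open>x \<noteq> 0\<close> by (simp add: field_simps)
      finally show ?case
        using add.IH by simp
    qed simp
    have "poly q (y / x) = lead_coeff q * (\<Prod>r\<in>#proots q. y / x - r)"
      by (subst complex_poly_decompose_multiset[of q, symmetric])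
         (simp add: poly_prod_mset image_mset.compositionality o_def)
    moreover have "poly q (y / x) = c * poly p y"
      using \<open>x \<noteq> 0\<close> by (subst q) (simp add: poly_pcompose)
    ultimately have "c * poly p y * x ^ degree q = lead_coeff q * (\<Prod>r\<in>#proots q. y - x * r)"
      using *[of "proots q"] by (simp add: size_proots_complex mult.assoc)
    then have "poly p y = k * (\<Prod>r\<in>#proots q. y - x * r)"
      using assms(1,2) by (simp add: k_def field_simps)
    then show ?thesis
      by (simp add: poly_prod_mset image_mset.compositionality o_def)
  qed
  then have "p = smult k (\<Prod>r\<in>#proots q. [:- (x * r), 1:])"
    by (intro poly_eq_poly_eq_iff[THEN iffD1] ext) auto
  moreover have "k \<noteq> 0"
    using assms(1-3) by (simp add: k_def)
  ultimately show "proots p = image_mset (\<lambda>r. x * r) (proots q)"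
    by (metis proots_smult proots_prod_mset_linear)
qed

section \<open>Limits of the rescaled entries and of the rescaled eigenvalues\<close>

lemma has_leading_term_scaled_tendsto:
  assumes "has_leading_term f a (Fin r)" "r \<ge> s"
  shows "((\<lambda>\<epsilon>. of_real (\<epsilon> powr - s) * f \<epsilon>) \<longlongrightarrow> (if r = s then a else 0)) (at_right 0)"
proof -
  have "(\<lambda>\<epsilon>. f \<epsilon> - a * of_real (\<epsilon> powr r)) \<in> o[at_right 0](\<lambda>\<epsilon>. of_real (\<epsilon> powr r) :: complex)"
    using assms(1) by (simp add: has_leading_term_def)
  then have lim: "((\<lambda>\<epsilon>. (f \<epsilon> - a * of_real (\<epsilon> powr r)) / of_real (\<epsilon> powr r) + a) \<longlongrightarrow> 0 + a) (at_right 0)"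
    by (intro tendsto_add tendsto_const smalloD_tendsto)
  have powr: "((\<lambda>\<epsilon>::real. \<epsilon> powr (r - s)) \<longlongrightarrow> (if r = s then 1 else 0)) (at_right 0)"
  proof (cases "r = s")
    case True
    then show ?thesis
      using eventually_at_right_less[of "0::real"] by (auto intro!: tendsto_eventually elim: eventually_mono)
  next
    case False
    have "((\<lambda>\<epsilon>::real. \<epsilon> powr (r - s)) \<longlongrightarrow> 0 powr (r - s)) (at_right 0)"
      using assms(2) False eventually_at_right_less[of "0::real"]
      by (intro tendsto_powr') (auto intro!: tendsto_intros elim: eventually_mono)
    then show ?thesis
      using False by simp
  qed
  have "((\<lambda>\<epsilon>. of_real (\<epsilon> powr (r - s)) * ((f \<epsilon> - a * of_real (\<epsilon> powr r)) / of_real (\<epsilon> powr r) + a))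
      \<longlongrightarrow> of_real (if r = s then 1 else 0) * (0 + a)) (at_right 0)"
    by (intro tendsto_mult lim tendsto_of_real powr)
  moreover have "\<forall>\<^sub>F \<epsilon> in at_right 0.
      of_real (\<epsilon> powr (r - s)) * ((f \<epsilon> - a * of_real (\<epsilon> powr r)) / of_real (\<epsilon> powr r) + a) =
      of_real (\<epsilon> powr - s) * f \<epsilon>"
    using eventually_at_right_less[of "0::real"]
  proof eventually_elim
    case (elim \<epsilon>)
    then have "(f \<epsilon> - a * of_real (\<epsilon> powr r)) / of_real (\<epsilon> powr r) + a = f \<epsilon> / of_real (\<epsilon> powr r)"
      by (simp add: field_simps)
    moreover have "\<epsilon> powr (r - s) = \<epsilon> powr - s * \<epsilon> powr r"
      by (simp flip: powr_add)
    ultimately show ?case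
      using elim by simp
  qed
  ultimately have "((\<lambda>\<epsilon>. of_real (\<epsilon> powr - s) * f \<epsilon>) \<longlongrightarrow> of_real (if r = s then 1 else 0) * (0 + a)) (at_right 0)"
    by (rule Lim_transform_eventually)
  then show ?thesis
    by (simp split: if_splits)
qed

text \<open>A finite entry with exponent \<open>r\<close> acquires the exponent
  \<open>r + real k * \<gamma> - U $ i - V $ j\<close>. The Hungarian inequality makes it
  nonnegative, and it vanishes exactly on the arcs of \<open>Sat_level\<close>.\<close>

lemma scaled_pencil_entry_tendsto:
  fixes A :: "nat \<Rightarrow> minplus ^ 'n ^ 'n"
  assumes H: "hungarian_pair (eval_matrix (pencil d A) (Fin \<gamma>)) U V" and "k \<le> d"
    and lead: "has_leading_term f c (A k $ i $ j)"
  shows "((\<lambda>\<epsilon>. of_real (\<epsilon> powr \<gamma>) ^ k * of_real (\<epsilon> powr - (U $ i)) * of_real (\<epsilon> powr - (V $ j)) * f \<epsilon>)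
    \<longlongrightarrow> (if (i, j) \<in> Sat_level d A \<gamma> U V k then c else 0)) (at_right 0)"
proof (cases "A k $ i $ j")
  case Infty
  then have "(i, j) \<notin> Sat_level d A \<gamma> U V k"
    by (auto simp: Sat_level_def Sat_def tight_arcs_def)
  moreover
  obtain \<delta> where \<delta>: "\<delta> > 0" "\<forall>\<epsilon>\<in>{0..<\<delta>}. f \<epsilon> = 0"
    using lead Infty by (auto simp: has_leading_term_def)
  have "\<forall>\<^sub>F \<epsilon> in at_right 0. f \<epsilon> = 0"
    by (rule eventually_at_rightI[of 0 \<delta>]) (use \<delta> in auto)
  then have "\<forall>\<^sub>F \<epsilon> in at_right 0.
      of_real (\<epsilon> powr \<gamma>) ^ k * of_real (\<epsilon> powr - (U $ i)) * of_real (\<epsilon> powr - (V $ j)) * f \<epsilon> = 0"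
    by eventually_elim simp
  ultimately show ?thesis
    by (simp add: tendsto_eventually)
next
  case (Fin r)
  define s where "s = U $ i + V $ j - real k * \<gamma>"
  define b where "b = eval_matrix (pencil d A) (Fin \<gamma>) $ i $ j"
  \<comment> \<open>\<open>b\<close> lies between the dual value and the value of level
    \<open>k\<close>. Hence \<open>r = s\<close> forces equality on both sides: saturation and
    tightness together.\<close>
  have b: "Fin (U $ i + V $ j) \<le> b" "b \<le> Fin (r + real k * \<gamma>)"
    using H eval_pencil_entry_le[OF \<open>k \<le> d\<close>, of A \<gamma> i j] by (auto simp: hungarian_pair_def b_def Fin)
  then have "(i, j) \<in> Sat_level d A \<gamma> U V k \<longleftrightarrow> r = s"
    by (cases b) (auto simp: Sat_level_def Sat_def tight_arcs_def s_def Fin b_def[symmetric])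
  moreover have "s \<le> r"
    using b by (cases b) (auto simp: s_def)
  ultimately have "((\<lambda>\<epsilon>. of_real (\<epsilon> powr - s) * f \<epsilon>) \<longlongrightarrow>
      (if (i, j) \<in> Sat_level d A \<gamma> U V k then c else 0)) (at_right 0)"
    using has_leading_term_scaled_tendsto[of f c r s] lead Fin by simp
  moreover have "\<forall>\<^sub>F \<epsilon> in at_right 0. of_real (\<epsilon> powr - s) * f \<epsilon> =
      of_real (\<epsilon> powr \<gamma>) ^ k * of_real (\<epsilon> powr - (U $ i)) * of_real (\<epsilon> powr - (V $ j)) * f \<epsilon>"
    using eventually_at_right_less[of "0::real"]
  proof eventually_elim
    case (elim \<epsilon>)
    then have "(\<epsilon> powr \<gamma>) ^ k * \<epsilon> powr - (U $ i) * \<epsilon> powr - (V $ j) = \<epsilon> powr - s"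
      by (simp add: s_def powr_power flip: powr_add) (simp add: algebra_simps)
    then show ?case
      by (simp flip: of_real_mult of_real_power)
  qed
  ultimately show ?thesis
    by (rule Lim_transform_eventually)
qed

text \<open>\<open>L\<close> and \<open>W\<close> hold the eigenvalues divided by
  \<open>\<epsilon> powr \<gamma>\<close>. Nonzero and zero limits are treated alike here, so
  continuity of roots applies once to the whole list \<open>zs\<close>.\<close>

theorem eigenvalues_asymptotics:
  fixes \<A> :: "real \<Rightarrow> nat \<Rightarrow> complex ^ 'n ^ 'n"
  assumes lead: "\<And>k i j. k \<le> d \<Longrightarrow>
      has_leading_term (\<lambda>\<epsilon>. \<A> \<epsilon> k $ i $ j) (a k $ i $ j) (A k $ i $ j)"
    and adm: "admissible_arcs d A \<gamma> U V G"
    and nz: "det (aux_pencil d a G) \<noteq> 0" and zs: "eigenvalues (aux_pencil d a G) = mset zs"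
  shows "\<exists>L W.
    (\<forall>\<^sub>F \<epsilon> in at_right 0. det (pencil d (\<A> \<epsilon>)) \<noteq> 0 \<and> eigenvalues (pencil d (\<A> \<epsilon>)) =
       image_mset (\<lambda>r. of_real (\<epsilon> powr \<gamma>) * r) (mset (map (\<lambda>i. L i \<epsilon>) [0..<length zs]) + W \<epsilon>)) \<and>
    (\<forall>i<length zs. (L i \<longlongrightarrow> zs ! i) (at_right 0)) \<and>
    (\<forall>R. \<forall>\<^sub>F \<epsilon> in at_right 0. \<forall>\<mu>\<in>#W \<epsilon>. cmod \<mu> > R)"
proof -
  have H: "hungarian_pair (eval_matrix (pencil d A) (Fin \<gamma>)) U V"
    using adm by (simp add: admissible_arcs_def)
  define x :: "real \<Rightarrow> complex" where "x \<epsilon> = of_real (\<epsilon> powr \<gamma>)" for \<epsilon>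
  define u :: "real \<Rightarrow> 'n \<Rightarrow> complex" where "u \<epsilon> i = of_real (\<epsilon> powr - (U $ i))" for \<epsilon> i
  define v :: "real \<Rightarrow> 'n \<Rightarrow> complex" where "v \<epsilon> j = of_real (\<epsilon> powr - (V $ j))" for \<epsilon> j
  define p where "p \<epsilon> = det (pencil d (\<lambda>k. \<chi> i j. x \<epsilon> ^ k * u \<epsilon> i * v \<epsilon> j * \<A> \<epsilon> k $ i $ j))" for \<epsilon>
  \<comment> \<open>The entries converge to those of the saturated pencil, whatever \<open>G\<close>
    is. Arcs on no optimal permutation disappear only in the determinant.\<close>
  have "((\<lambda>\<epsilon>. coeff (p \<epsilon>) n) \<longlongrightarrow> coeff (det (aux_pencil d a (Sat_level d A \<gamma> U V))) n) (at_right 0)" for n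
    unfolding p_def aux_pencil_def
    by (rule tendsto_coeff_det_pencil)
      (use scaled_pencil_entry_tendsto[OF H _ lead] in \<open>simp add: restrict_matrix_def x_def u_def v_def\<close>)
  then have "((\<lambda>\<epsilon>. coeff (p \<epsilon>) n) \<longlongrightarrow> coeff (det (aux_pencil d a G)) n) (at_right 0)" for n
    by (simp add: det_aux_pencil_eq_Sat[OF adm])
  moreover have "\<forall>\<^sub>F \<epsilon> in at_right 0. degree (p \<epsilon>) \<le> CARD('n) * d"
    unfolding p_def by (intro always_eventually allI degree_det_pencil_le)
  moreover have "at_right (0::real) \<noteq> bot"
    by simp
  ultimately have "\<exists>L W. (\<forall>\<^sub>F \<epsilon> in at_right 0.
      p \<epsilon> \<noteq> 0 \<and> proots (p \<epsilon>) = mset (map (\<lambda>i. L i \<epsilon>) [0..<length zs]) + W \<epsilon>) \<and>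
    (\<forall>i<length zs. (L i \<longlongrightarrow> zs ! i) (at_right 0)) \<and>
    (\<forall>R. \<forall>\<^sub>F \<epsilon> in at_right 0. \<forall>\<mu>\<in>#W \<epsilon>. cmod \<mu> > R)"
    using nz zs by (intro roots_tendsto) (auto simp: eigenvalues_def)
  then obtain L W where LW: "\<forall>\<^sub>F \<epsilon> in at_right 0.
      p \<epsilon> \<noteq> 0 \<and> proots (p \<epsilon>) = mset (map (\<lambda>i. L i \<epsilon>) [0..<length zs]) + W \<epsilon>"
    "\<And>i. i < length zs \<Longrightarrow> (L i \<longlongrightarrow> zs ! i) (at_right 0)"
    "\<And>R. \<forall>\<^sub>F \<epsilon> in at_right 0. \<forall>\<mu>\<in>#W \<epsilon>. cmod \<mu> > R"
    by blast
  have "\<forall>\<^sub>F \<epsilon> in at_right 0. det (pencil d (\<A> \<epsilon>)) \<noteq> 0 \<and> eigenvalues (pencil d (\<A> \<epsilon>)) =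
       image_mset (\<lambda>r. of_real (\<epsilon> powr \<gamma>) * r) (mset (map (\<lambda>i. L i \<epsilon>) [0..<length zs]) + W \<epsilon>)"
    using LW(1) eventually_at_right_less[of "0::real"]
  proof eventually_elim
    case (elim \<epsilon>)
    have "(\<Prod>i\<in>UNIV. u \<epsilon> i) * (\<Prod>j\<in>UNIV. v \<epsilon> j) \<noteq> 0" "x \<epsilon> \<noteq> 0"
      using elim by (auto simp: u_def v_def x_def)
    note * = proots_scaled[OF this, of "p \<epsilon>" "det (pencil d (\<A> \<epsilon>))"]
    show ?case
      using * elim(1) by (simp add: p_def coeff_det_pencil_scaled eigenvalues_def x_def)
  qed
  then show ?thesis
    using LW(2,3) by blast
qed

section \<open>Polynomial functions of several variables\<close>

definition monomial_value :: "('v \<Rightarrow>\<^sub>0 nat) \<Rightarrow> ('v \<Rightarrow> complex) \<Rightarrow> complex" where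
  "monomial_value m x = (\<Prod>v\<in>Poly_Mapping.keys m. x v ^ Poly_Mapping.lookup m v)"

lemma mvpoly_eval_eq:
  "mvpoly_eval Q x = (\<Sum>m\<in>Poly_Mapping.keys Q. Poly_Mapping.lookup Q m * monomial_value m x)"
  by (simp add: mvpoly_eval_def monomial_value_def)

lemma monomial_value_superset:
  assumes "finite S" "Poly_Mapping.keys m \<subseteq> S"
  shows "monomial_value m x = (\<Prod>v\<in>S. x v ^ Poly_Mapping.lookup m v)"
  unfolding monomial_value_def
  by (rule prod.mono_neutral_left) (use assms in \<open>auto simp: in_keys_iff\<close>)

lemma monomial_value_add: "monomial_value (m + m') x = monomial_value m x * monomial_value m' x"
proof -
  let ?S = "Poly_Mapping.keys m \<union> Poly_Mapping.keys m'"
  have "monomial_value (m + m') x = (\<Prod>v\<in>?S. x v ^ Poly_Mapping.lookup (m + m') v)"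
    by (rule monomial_value_superset) (auto simp: keys_add)
  also have "\<dots> = (\<Prod>v\<in>?S. x v ^ Poly_Mapping.lookup m v) * (\<Prod>v\<in>?S. x v ^ Poly_Mapping.lookup m' v)"
    by (simp add: lookup_add power_add prod.distrib)
  also have "\<dots> = monomial_value m x * monomial_value m' x"
    by (subst (1 2) monomial_value_superset[of ?S]) auto
  finally show ?thesis .
qed

lemma mvpoly_eval_0 [simp]: "mvpoly_eval 0 x = 0"
  by (simp add: mvpoly_eval_def)

lemma mvpoly_eval_add: "mvpoly_eval (Q + R) x = mvpoly_eval Q x + mvpoly_eval R x"
  unfolding mvpoly_eval_eq by (rule setsum_keys_plus_distrib) (simp_all add: algebra_simps)

lemma mvpoly_eval_sum: "mvpoly_eval (\<Sum>i\<in>I. Q i) x = (\<Sum>i\<in>I. mvpoly_eval (Q i) x)"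
  by (induction I rule: infinite_finite_induct) (auto simp: mvpoly_eval_add)

lemma mvpoly_eval_single: "mvpoly_eval (Poly_Mapping.single m c) x = c * monomial_value m x"
  by (simp add: mvpoly_eval_eq)

lemma mvpoly_eq_sum_single:
  "Q = (\<Sum>m\<in>Poly_Mapping.keys Q. Poly_Mapping.single m (Poly_Mapping.lookup Q m))"
proof (rule poly_mapping_eqI)
  fix m
  show "Poly_Mapping.lookup Q m =
      Poly_Mapping.lookup (\<Sum>m\<in>Poly_Mapping.keys Q. Poly_Mapping.single m (Poly_Mapping.lookup Q m)) m"
    by (simp add: lookup_sum lookup_single when_def in_keys_iff)
qed

lemma mvpoly_eval_mult: "mvpoly_eval (Q * R) x = mvpoly_eval Q x * mvpoly_eval R x"
proof -
  have "Q * R = (\<Sum>m\<in>Poly_Mapping.keys Q. \<Sum>m'\<in>Poly_Mapping.keys R.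
      Poly_Mapping.single (m + m') (Poly_Mapping.lookup Q m * Poly_Mapping.lookup R m'))"
    by (subst mvpoly_eq_sum_single[of Q], subst mvpoly_eq_sum_single[of R])
      (simp add: sum_product mult_single)
  then have "mvpoly_eval (Q * R) x = (\<Sum>m\<in>Poly_Mapping.keys Q. \<Sum>m'\<in>Poly_Mapping.keys R.
      (Poly_Mapping.lookup Q m * monomial_value m x) * (Poly_Mapping.lookup R m' * monomial_value m' x))"
    by (simp add: mvpoly_eval_sum mvpoly_eval_single monomial_value_add mult_ac)
  then show ?thesis
    by (simp add: mvpoly_eval_eq sum_product)
qed

text \<open>Working with functions, closure under sums and products suffices to recognize a
  determinant coefficient as a polynomial, with no explicit family of coefficients. \<open>X\<close>
  bounds the variables, as \<open>generically\<close> demands.\<close>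

definition mvpolyfun :: "'v set \<Rightarrow> (('v \<Rightarrow> complex) \<Rightarrow> complex) \<Rightarrow> bool" where
  "mvpolyfun X f \<longleftrightarrow> (\<exists>Q. mvpoly_vars Q \<subseteq> X \<and> (\<forall>x. f x = mvpoly_eval Q x))"

lemma mvpolyfun_const: "mvpolyfun X (\<lambda>_. c)"
  unfolding mvpolyfun_def
  by (rule exI[of _ "Poly_Mapping.single 0 c"])
    (auto simp: mvpoly_vars_def mvpoly_eval_single monomial_value_def split: if_splits)

lemma mvpolyfun_var: "v \<in> X \<Longrightarrow> mvpolyfun X (\<lambda>x. x v)"
  unfolding mvpolyfun_def
  by (rule exI[of _ "Poly_Mapping.single (Poly_Mapping.single v 1) 1"])
    (auto simp: mvpoly_vars_def mvpoly_eval_single monomial_value_def split: if_splits)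

lemma mvpolyfun_add:
  assumes "mvpolyfun X f" "mvpolyfun X g"
  shows "mvpolyfun X (\<lambda>x. f x + g x)"
proof -
  obtain Q R where QR: "mvpoly_vars Q \<subseteq> X" "\<forall>x. f x = mvpoly_eval Q x"
    "mvpoly_vars R \<subseteq> X" "\<forall>x. g x = mvpoly_eval R x"
    using assms by (auto simp: mvpolyfun_def)
  have "mvpoly_vars (Q + R) \<subseteq> mvpoly_vars Q \<union> mvpoly_vars R"
    using keys_add[of Q R] by (fastforce simp: mvpoly_vars_def)
  then show ?thesis
    unfolding mvpolyfun_def using QR by (intro exI[of _ "Q + R"]) (auto simp: mvpoly_eval_add)
qed

lemma mvpolyfun_mult:
  assumes "mvpolyfun X f" "mvpolyfun X g"
  shows "mvpolyfun X (\<lambda>x. f x * g x)"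
proof -
  obtain Q R where QR: "mvpoly_vars Q \<subseteq> X" "\<forall>x. f x = mvpoly_eval Q x"
    "mvpoly_vars R \<subseteq> X" "\<forall>x. g x = mvpoly_eval R x"
    using assms by (auto simp: mvpolyfun_def)
  have "mvpoly_vars (Q * R) \<subseteq> mvpoly_vars Q \<union> mvpoly_vars R"
  proof
    fix v assume "v \<in> mvpoly_vars (Q * R)"
    then obtain m m' where "m \<in> Poly_Mapping.keys Q" "m' \<in> Poly_Mapping.keys R"
      "v \<in> Poly_Mapping.keys (m + m')"
      using keys_mult[of Q R] by (fastforce simp: mvpoly_vars_def)
    then show "v \<in> mvpoly_vars Q \<union> mvpoly_vars R"
      using keys_add[of m m'] by (fastforce simp: mvpoly_vars_def)
  qed
  then show ?thesis
    unfolding mvpolyfun_def using QR by (intro exI[of _ "Q * R"]) (auto simp: mvpoly_eval_mult)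
qed

lemma mvpolyfun_sum: "(\<And>i. i \<in> I \<Longrightarrow> mvpolyfun X (f i)) \<Longrightarrow> mvpolyfun X (\<lambda>x. \<Sum>i\<in>I. f i x)"
  by (induction I rule: infinite_finite_induct) (simp_all add: mvpolyfun_const mvpolyfun_add)

lemma mvpolyfun_prod: "(\<And>i. i \<in> I \<Longrightarrow> mvpolyfun X (f i)) \<Longrightarrow> mvpolyfun X (\<lambda>x. \<Prod>i\<in>I. f i x)"
  by (induction I rule: infinite_finite_induct) (simp_all add: mvpolyfun_const mvpolyfun_mult)

section \<open>Restriction to lines, and a criterion for genericity\<close>

lemma mvpolyfun_on_line:
  assumes "mvpolyfun X f"
  obtains p where "\<And>s. f (\<lambda>v. x v + s * (y v - x v)) = poly p s"
proof -
  obtain Q where Q: "\<And>x. f x = mvpoly_eval Q x"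
    using assms by (auto simp: mvpolyfun_def)
  define p where "p = (\<Sum>m\<in>Poly_Mapping.keys Q. smult (Poly_Mapping.lookup Q m)
    (\<Prod>v\<in>Poly_Mapping.keys m. [:x v, y v - x v:] ^ Poly_Mapping.lookup m v))"
  have "f (\<lambda>v. x v + s * (y v - x v)) = poly p s" for s
    by (simp add: Q p_def mvpoly_eval_def poly_sum poly_prod)
  then show ?thesis ..
qed

text \<open>On the line through the two points the functions become nonzero univariate polynomials.\<close>

lemma mvpolyfun_common_nonzero:
  assumes "mvpolyfun X f" "mvpolyfun X g" "f x \<noteq> 0" "g y \<noteq> 0"
  shows "\<exists>z. f z \<noteq> 0 \<and> g z \<noteq> 0"
proof -
  obtain p where p: "\<And>s. f (\<lambda>v. x v + s * (y v - x v)) = poly p s"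
    using mvpolyfun_on_line[where x = x and y = y, OF assms(1)] by blast
  obtain q where q: "\<And>s. g (\<lambda>v. x v + s * (y v - x v)) = poly q s"
    using mvpolyfun_on_line[where x = x and y = y, OF assms(2)] by blast
  have "p \<noteq> 0" "q \<noteq> 0"
    using p[of 0] q[of 1] assms(3,4) by auto
  then obtain s where s: "poly (p * q) s \<noteq> 0"
    using poly_all_0_iff_0[of "p * q"] by auto
  show ?thesis
    by (rule exI[of _ "\<lambda>v. x v + s * (y v - x v)"]) (use s in \<open>simp_all add: p q\<close>)
qed

text \<open>The two functions are known to be nonzero at possibly different points, whereas
  genericity asks for one polynomial. A common point of nonvanishing shows that their product comes
  from a nonzero one.\<close>

lemma genericallyI:
  fixes \<Phi> :: "(nat \<Rightarrow> complex ^ 'n ^ 'n) \<Rightarrow> bool"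
  assumes "mvpolyfun ({..d} \<times> UNIV) f" "mvpolyfun ({..d} \<times> UNIV) g" "f x \<noteq> 0" "g y \<noteq> 0"
    and "\<And>a. f (\<lambda>(k, i, j). a k $ i $ j) \<noteq> 0 \<Longrightarrow> g (\<lambda>(k, i, j). a k $ i $ j) \<noteq> 0 \<Longrightarrow> \<Phi> a"
  shows "generically d \<Phi>"
proof -
  obtain z where z: "f z \<noteq> 0" "g z \<noteq> 0"
    using mvpolyfun_common_nonzero[of _ f g x y] assms(1-4) by blast
  have "mvpolyfun ({..d} \<times> UNIV) (\<lambda>x. f x * g x)"
    using assms(1,2) by (rule mvpolyfun_mult)
  then obtain Q where Q: "mvpoly_vars Q \<subseteq> {..d} \<times> UNIV" "\<And>x. f x * g x = mvpoly_eval Q x"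
    unfolding mvpolyfun_def by blast
  have "Q \<noteq> 0"
    using Q(2)[of z] z by auto
  moreover have "\<Phi> a" if "mvpoly_eval Q (\<lambda>(k, i, j). a k $ i $ j) \<noteq> 0" for a
    using that assms(5) unfolding Q(2)[symmetric] by simp
  ultimately show ?thesis
    unfolding generically_def using Q(1) by blast
qed

section \<open>The determinant of the auxiliary pencil\<close>

lemma perm_eval_neq_Infty: "admissible_arcs d A \<gamma> U V G \<Longrightarrow> perm (eval_matrix (pencil d A) (Fin \<gamma>)) \<noteq> Infty"
  unfolding admissible_arcs_def hungarian_pair_def by (metis minplus.distinct(1))

lemma poly_minplus_le_monomial: "poly P (Fin x) \<le> coeff P n * Fin (real n * x)"
proof (cases "n \<le> degree P")
  case True
  then show ?thesis
    unfolding minplus_poly_eq_sum by (intro sum_minplus_le) auto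
next
  case False
  then show ?thesis
    by (simp add: coeff_eq_0 zero_minplus_def)
qed

lemma prod_level_weights:
  assumes "\<kappa> \<in> level_choices d n"
  shows "(\<Prod>i\<in>UNIV. A (\<kappa> i) $ i $ \<sigma> i * Fin (real (\<kappa> i) * \<gamma>)) =
    (\<Prod>i\<in>UNIV. A (\<kappa> i) $ i $ \<sigma> i) * Fin (real n * \<gamma>)"
  using assms by (auto simp: level_choices_def prod.distrib prod_Fin sum_distrib_right)

text \<open>A nonzero coefficient contains a surviving term, whose min-plus weight bounds the
  monomial of degree \<open>n\<close> from above; the value of the min-plus polynomial at
  \<open>\<gamma>\<close> bounds it from below. This holds for every \<open>b\<close>: special
  coefficients can only shrink the set of exponents.\<close>

lemma coeff_det_aux_pencil_support:
  assumes adm: "admissible_arcs d A \<gamma> U V G" and nz: "coeff (det (aux_pencil d b G)) n \<noteq> 0"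
  shows "coeff (perm (pencil d A)) n * Fin (real n * \<gamma>) = perm (eval_matrix (pencil d A) (Fin \<gamma>))"
proof (rule antisym)
  let ?w = "perm (eval_matrix (pencil d A) (Fin \<gamma>))"
  obtain \<sigma> \<kappa> where \<sigma>: "\<sigma> permutes UNIV" and \<kappa>: "\<kappa> \<in> level_choices d n"
    and w: "(\<Prod>i\<in>UNIV. A (\<kappa> i) $ i $ \<sigma> i * Fin (real (\<kappa> i) * \<gamma>)) = ?w"
    using nz unfolding coeff_det_aux_pencil[OF adm]
    by (auto elim!: sum.not_neutral_contains_not_neutral split: if_splits)
  have "coeff (perm (pencil d A)) n \<le> (\<Sum>\<kappa>\<in>level_choices d n. \<Prod>i\<in>UNIV. A (\<kappa> i) $ i $ \<sigma> i)"
    unfolding coeff_perm_pencil using \<sigma> by (intro sum_minplus_le) (auto simp: finite_permutations)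
  also have "\<dots> \<le> (\<Prod>i\<in>UNIV. A (\<kappa> i) $ i $ \<sigma> i)"
    using \<kappa> by (intro sum_minplus_le) auto
  finally have "coeff (perm (pencil d A)) n * Fin (real n * \<gamma>) \<le>
      (\<Prod>i\<in>UNIV. A (\<kappa> i) $ i $ \<sigma> i) * Fin (real n * \<gamma>)"
    using order_refl by (rule times_minplus_mono)
  also have "\<dots> = ?w"
    unfolding prod_level_weights[OF \<kappa>, symmetric] by (rule w)
  finally show "coeff (perm (pencil d A)) n * Fin (real n * \<gamma>) \<le> ?w" .
  show "?w \<le> coeff (perm (pencil d A)) n * Fin (real n * \<gamma>)"
    unfolding poly_perm[symmetric] by (rule poly_minplus_le_monomial)
qed

text \<open>Surviving terms of the same exponent might cancel. Taking for \<open>b\<close> the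
  indicator of one optimal pair of a permutation and a choice of levels kills all others and leaves
  the sign of the permutation.\<close>

lemma coeff_det_aux_pencil_attained:
  fixes A :: "nat \<Rightarrow> minplus ^ 'n ^ 'n"
  assumes adm: "admissible_arcs d A \<gamma> U V G"
    and eq: "coeff (perm (pencil d A)) n * Fin (real n * \<gamma>) = perm (eval_matrix (pencil d A) (Fin \<gamma>))"
  obtains b where "coeff (det (aux_pencil d b G)) n \<noteq> 0"
proof -
  let ?w = "perm (eval_matrix (pencil d A) (Fin \<gamma>))"
  let ?P = "\<lambda>\<sigma> \<kappa>. \<Prod>i\<in>UNIV. A (\<kappa> i) $ i $ \<sigma> i"
  have fin: "coeff (perm (pencil d A)) n \<noteq> Infty"
    using eq perm_eval_neq_Infty[OF adm] by auto
  have "\<exists>\<sigma>\<in>{\<sigma>. \<sigma> permutes UNIV}. (\<Sum>\<kappa>\<in>level_choices d n. ?P \<sigma> \<kappa>) = coeff (perm (pencil d A)) n"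
    unfolding coeff_perm_pencil
    by (rule sum_minplus_attained) (use fin in \<open>auto simp: finite_permutations coeff_perm_pencil\<close>)
  then obtain \<sigma> where \<sigma>: "\<sigma> permutes UNIV" "(\<Sum>\<kappa>\<in>level_choices d n. ?P \<sigma> \<kappa>) = coeff (perm (pencil d A)) n"
    by auto
  have "\<exists>\<kappa>\<in>level_choices d n. ?P \<sigma> \<kappa> = (\<Sum>\<kappa>\<in>level_choices d n. ?P \<sigma> \<kappa>)"
    by (rule sum_minplus_attained) (use fin \<sigma> in auto)
  then obtain \<kappa> where \<kappa>: "\<kappa> \<in> level_choices d n" "?P \<sigma> \<kappa> = coeff (perm (pencil d A)) n"
    using \<sigma> by auto
  have w: "(\<Prod>i\<in>UNIV. A (\<kappa> i) $ i $ \<sigma> i * Fin (real (\<kappa> i) * \<gamma>)) = ?w"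
    unfolding prod_level_weights[OF \<kappa>(1)] \<kappa>(2) by (rule eq)
  define b :: "nat \<Rightarrow> complex ^ 'n ^ 'n" where "b k = (\<chi> i j. if k = \<kappa> i \<and> j = \<sigma> i then 1 else 0)" for k
  have b: "(\<Prod>i\<in>UNIV. b (\<kappa>' i) $ i $ \<tau> i) = (if \<tau> = \<sigma> \<and> \<kappa>' = \<kappa> then 1 else 0)" for \<tau> \<kappa>'
  proof (cases "\<tau> = \<sigma> \<and> \<kappa>' = \<kappa>")
    case False
    then have "\<exists>i. \<not> (\<kappa>' i = \<kappa> i \<and> \<tau> i = \<sigma> i)"
      by auto
    then have "(\<Prod>i\<in>UNIV. b (\<kappa>' i) $ i $ \<tau> i) = 0"
      by (intro prod_zero) (auto simp: b_def)
    then show ?thesis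
      using False by auto
  qed (simp add: b_def)
  have inner: "(\<Sum>\<kappa>'\<in>level_choices d n.
      if (\<Prod>i\<in>UNIV. A (\<kappa>' i) $ i $ \<tau> i * Fin (real (\<kappa>' i) * \<gamma>)) = ?w
      then \<Prod>i\<in>UNIV. b (\<kappa>' i) $ i $ \<tau> i else 0) = (if \<tau> = \<sigma> then 1 else 0)" for \<tau>
  proof -
    have "(if (\<Prod>i\<in>UNIV. A (\<kappa>' i) $ i $ \<tau> i * Fin (real (\<kappa>' i) * \<gamma>)) = ?w
        then \<Prod>i\<in>UNIV. b (\<kappa>' i) $ i $ \<tau> i else 0) = (if \<kappa>' = \<kappa> then if \<tau> = \<sigma> then 1 else 0 else 0)" for \<kappa>'
      using w unfolding b by auto
    then show ?thesis
      using \<kappa>(1) by (simp add: sum.delta)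
  qed
  have "coeff (det (aux_pencil d b G)) n = of_int (sign \<sigma>)"
    unfolding coeff_det_aux_pencil[OF adm] inner
    using \<sigma>(1) by (simp add: finite_permutations if_distrib cong: if_cong)
  then have "coeff (det (aux_pencil d b G)) n \<noteq> 0"
    by (simp add: sign_def)
  then show ?thesis ..
qed

lemma mvpolyfun_coeff_det_aux_pencil:
  fixes G :: "nat \<Rightarrow> ('n::finite \<times> 'n) set"
  shows "mvpolyfun ({..d} \<times> UNIV) (\<lambda>x. coeff (det (aux_pencil d (\<lambda>k. \<chi> i j. x (k, i, j)) G)) n)"
proof -
  have "mvpolyfun ({..d} \<times> UNIV)
      (\<lambda>x. restrict_matrix (\<chi> i j. x (k, i, j)) (G k) $ i $ j)" if "k \<le> d" for k i j
    using that by (cases "(i, j) \<in> G k") (simp_all add: restrict_matrix_def mvpolyfun_var mvpolyfun_const)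
  then show ?thesis
    unfolding aux_pencil_def coeff_det_pencil
    by (intro mvpolyfun_sum mvpolyfun_mult mvpolyfun_prod mvpolyfun_const) (auto simp: level_choices_def)
qed

lemma order_0_eqI:
  assumes "coeff p m \<noteq> 0" "\<And>k. coeff p k \<noteq> 0 \<Longrightarrow> m \<le> k"
  shows "order 0 p = m"
proof (rule antisym)
  have "p \<noteq> 0"
    using assms(1) by auto
  then show "order 0 p \<le> m" "m \<le> order 0 p"
    using assms monom_1_dvd_iff[of p] monom_1_dvd_iff'[of _ p]
    by (metis not_le order_refl, meson leD)
qed

text \<open>All exponents lie between \<open>m\<close> and \<open>M\<close> for every
  \<open>b\<close>, so it is enough to keep the two extreme coefficients nonzero; those in between
  may vanish. The degree counts all eigenvalues, the order at zero the vanishing ones.\<close>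

lemma generic_eigenvalue_counts:
  fixes A :: "nat \<Rightarrow> minplus ^ 'n ^ 'n"
  assumes adm: "admissible_arcs d A \<gamma> U V G"
  shows "generically d (\<lambda>b. det (aux_pencil d b G) \<noteq> 0 \<and>
      size {#z \<in># eigenvalues (aux_pencil d b G). z \<noteq> 0#} =
        count (corners (perm (pencil d A))) (Fin \<gamma>) \<and>
      count (eigenvalues (aux_pencil d b G)) 0 =
        (\<Sum>c | c \<in># corners (perm (pencil d A)) \<and> c > Fin \<gamma>. count (corners (perm (pencil d A))) c))"
proof -
  define P where "P = perm (pencil d A)"
  obtain w where w: "perm (eval_matrix (pencil d A) (Fin \<gamma>)) = Fin w"
    using perm_eval_neq_Infty[OF adm] by (metis minplus.exhaust)
  have Pw: "poly P (Fin \<gamma>) = Fin w"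
    unfolding P_def poly_perm by (rule w)
  define K where "K = {n. coeff P n * Fin (real n * \<gamma>) = Fin w}"
  have "K \<subseteq> {..degree P}"
    using coeff_eq_0[of P] by (force simp: K_def zero_minplus_def not_le[symmetric])
  then have finK: "finite K"
    by (rule finite_subset) simp
  have "\<exists>n\<in>{..degree P}. coeff P n * Fin (real n * \<gamma>) = (\<Sum>n\<le>degree P. coeff P n * Fin (real n * \<gamma>))"
    by (rule sum_minplus_attained) (use Pw in \<open>auto simp: minplus_poly_eq_sum\<close>)
  then have "K \<noteq> {}"
    using Pw by (auto simp: K_def minplus_poly_eq_sum)
  define m where "m = Min K"
  define M where "M = Max K"
  have mM: "m \<in> K" "M \<in> K" "\<And>k. k \<in> K \<Longrightarrow> m \<le> k \<and> k \<le> M"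
    using finK \<open>K \<noteq> {}\<close> by (auto simp: m_def M_def)
  have corners: "count (corners P) (Fin \<gamma>) = M - m"
    "(\<Sum>c | c \<in># corners P \<and> c > Fin \<gamma>. count (corners P) c) = m"
    using mM by (intro count_corners[OF Pw, of m M]; simp add: K_def)+
  have support: "n \<in> K" if "coeff (det (aux_pencil d b G)) n \<noteq> 0" for b n
    using coeff_det_aux_pencil_support[OF adm that] by (simp add: K_def P_def w)
  have attained: "\<exists>x. coeff (det (aux_pencil d (\<lambda>k. \<chi> i j. x (k, i, j)) G)) n \<noteq> 0" if n: "n \<in> K" for n
  proof -
    have "coeff (perm (pencil d A)) n * Fin (real n * \<gamma>) = perm (eval_matrix (pencil d A) (Fin \<gamma>))"
      using n by (simp add: K_def P_def w)
    then obtain b where "coeff (det (aux_pencil d b G)) n \<noteq> 0"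
      using coeff_det_aux_pencil_attained[OF adm] by blast
    moreover have "(\<lambda>k. \<chi> i j. (\<lambda>(k, i, j). b k $ i $ j) (k, i, j)) = b"
      by (simp add: vec_eq_iff fun_eq_iff)
    ultimately show ?thesis
      by metis
  qed
  obtain x y where xy: "coeff (det (aux_pencil d (\<lambda>k. \<chi> i j. x (k, i, j)) G)) m \<noteq> 0"
    "coeff (det (aux_pencil d (\<lambda>k. \<chi> i j. y (k, i, j)) G)) M \<noteq> 0"
    using attained[OF mM(1)] attained[OF mM(2)] by blast
  show ?thesis
  proof (rule genericallyI[OF mvpolyfun_coeff_det_aux_pencil mvpolyfun_coeff_det_aux_pencil xy])
    fix b :: "nat \<Rightarrow> complex ^ 'n ^ 'n"
    let ?q = "det (aux_pencil d b G)"
    assume "coeff (det (aux_pencil d (\<lambda>k. \<chi> i j. case (k, i, j) of (k, i, j) \<Rightarrow> b k $ i $ j) G)) m \<noteq> 0"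
      and "coeff (det (aux_pencil d (\<lambda>k. \<chi> i j. case (k, i, j) of (k, i, j) \<Rightarrow> b k $ i $ j) G)) M \<noteq> 0"
    then have nz: "coeff ?q m \<noteq> 0" "coeff ?q M \<noteq> 0"
      by simp_all
    then have "?q \<noteq> 0"
      by auto
    have "degree ?q = M"
      using nz(2) support mM(3) \<open>?q \<noteq> 0\<close> by (metis antisym le_degree leading_coeff_0_iff)
    then have size: "size (eigenvalues (aux_pencil d b G)) = M"
      by (simp add: eigenvalues_def size_proots_complex)
    have "order 0 ?q = m"
      by (rule order_0_eqI) (use nz support mM(3) in auto)
    then have count: "count (eigenvalues (aux_pencil d b G)) 0 = m"
      using \<open>?q \<noteq> 0\<close> by (simp add: eigenvalues_def)
    have "size S = count S 0 + size {#z \<in># S. z \<noteq> 0#}" for S :: "complex multiset"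
      by (induction S) auto
    then have "size {#z \<in># eigenvalues (aux_pencil d b G). z \<noteq> 0#} = M - m"
      using size count by (metis add_diff_cancel_left')
    then show "?q \<noteq> 0 \<and>
        size {#z \<in># eigenvalues (aux_pencil d b G). z \<noteq> 0#} = count (corners (perm (pencil d A))) (Fin \<gamma>) \<and>
        count (eigenvalues (aux_pencil d b G)) 0 =
          (\<Sum>c | c \<in># corners (perm (pencil d A)) \<and> c > Fin \<gamma>. count (corners (perm (pencil d A))) c)"
      using \<open>?q \<noteq> 0\<close> count corners by (simp add: P_def)
  qed
qed

text \<open>If the given pair is not Hungarian, every level up to \<open>d\<close> must be an
  \<open>Opt_level\<close>, and any pair obtained from duality will do. Duality applies because a
  polynomial with a corner is nonzero, which makes the permanent at \<open>\<gamma>\<close>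
  finite.\<close>

lemma exists_admissible_arcs:
  fixes A :: "nat \<Rightarrow> minplus ^ 'n ^ 'n"
  assumes corner: "Fin \<gamma> \<in># corners (perm (pencil d A))"
    and G: "\<And>k. k \<le> d \<Longrightarrow> G k = Opt_level d A \<gamma> k \<or>
      hungarian_pair (eval_matrix (pencil d A) (Fin \<gamma>)) U V \<and> G k = Sat_level d A \<gamma> U V k"
  obtains U' V' where "admissible_arcs d A \<gamma> U' V' G"
proof (cases "hungarian_pair (eval_matrix (pencil d A) (Fin \<gamma>)) U V")
  case True
  then have "admissible_arcs d A \<gamma> U V G"
    using G by (auto simp: admissible_arcs_def)
  then show ?thesis ..
next
  case False
  have "perm (pencil d A) \<noteq> 0"
    using corner by auto
  then have "perm (eval_matrix (pencil d A) (Fin \<gamma>)) \<noteq> Infty"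
    using poly_minplus_neq_Infty by (metis poly_perm)
  then obtain U' V' where "hungarian_pair (eval_matrix (pencil d A) (Fin \<gamma>)) U' V'"
    using exists_hungarian_pair by blast
  then have "admissible_arcs d A \<gamma> U' V' G"
    using G False by (auto simp: admissible_arcs_def)
  then show ?thesis ..
qed

theorem theorem1:
  fixes d :: nat
    and \<A> :: "real \<Rightarrow> nat \<Rightarrow> complex ^ 'n ^ 'n"
    and a :: "nat \<Rightarrow> complex ^ 'n ^ 'n"
    and A :: "nat \<Rightarrow> minplus ^ 'n ^ 'n"
    and \<gamma> :: real
    and U V :: "real ^ 'n"
    and G :: "nat \<Rightarrow> ('n \<times> 'n) set"
  assumes cont: "\<And>k i j. k \<le> d \<Longrightarrow> continuous_on {0..} (\<lambda>\<epsilon>. \<A> \<epsilon> k $ i $ j)"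
    and lead: "\<And>k i j. k \<le> d \<Longrightarrow>
      has_leading_term (\<lambda>\<epsilon>. \<A> \<epsilon> k $ i $ j) (a k $ i $ j) (A k $ i $ j)"
    and corner: "Fin \<gamma> \<in># corners (perm (pencil d A))"
    and G: "\<And>k. k \<le> d \<Longrightarrow> G k = Opt_level d A \<gamma> k \<or>
      hungarian_pair (eval_matrix (pencil d A) (Fin \<gamma>)) U V \<and> G k = Sat_level d A \<gamma> U V k"
  shows "(\<forall>lams m'. det (aux_pencil d a G) \<noteq> 0 \<and>
        mset lams = {#z \<in># eigenvalues (aux_pencil d a G). z \<noteq> 0#} \<and>
        m' = count (eigenvalues (aux_pencil d a G)) 0 \<longrightarrow>
      (\<exists>(L :: nat \<Rightarrow> real \<Rightarrow> complex) (Z :: nat \<Rightarrow> real \<Rightarrow> complex) (W :: real \<Rightarrow> complex multiset).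
        (\<forall>\<^sub>F \<epsilon> in at_right 0. det (pencil d (\<A> \<epsilon>)) \<noteq> 0 \<and>
           eigenvalues (pencil d (\<A> \<epsilon>)) =
             mset (map (\<lambda>i. L i \<epsilon>) [0..<length lams]) + mset (map (\<lambda>i. Z i \<epsilon>) [0..<m']) + W \<epsilon>) \<and>
        (\<forall>i<length lams. L i \<sim>[at_right 0] (\<lambda>\<epsilon>. lams ! i * of_real (\<epsilon> powr \<gamma>))) \<and>
        (\<forall>i<m'. ((\<lambda>\<epsilon>. of_real (\<epsilon> powr - \<gamma>) * Z i \<epsilon>) \<longlongrightarrow> 0) (at_right 0)) \<and>
        (\<forall>R. \<forall>\<^sub>F \<epsilon> in at_right 0. \<forall>\<mu>\<in>#W \<epsilon>. cmod (of_real (\<epsilon> powr - \<gamma>) * \<mu>) > R))) \<and>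
    generically d (\<lambda>b. det (aux_pencil d b G) \<noteq> 0 \<and>
      size {#z \<in># eigenvalues (aux_pencil d b G). z \<noteq> 0#} =
        count (corners (perm (pencil d A))) (Fin \<gamma>) \<and>
      count (eigenvalues (aux_pencil d b G)) 0 =
        (\<Sum>c | c \<in># corners (perm (pencil d A)) \<and> c > Fin \<gamma>. count (corners (perm (pencil d A))) c))"
proof -
  obtain U' V' where adm: "admissible_arcs d A \<gamma> U' V' G"
    using exists_admissible_arcs[OF corner G] .
  have pos: "\<forall>\<^sub>F \<epsilon>::real in at_right 0. \<epsilon> > 0"
    by (rule eventually_at_right_less)
  define x :: "real \<Rightarrow> complex" where "x \<epsilon> = of_real (\<epsilon> powr \<gamma>)" for \<epsilon>
  have x: "x \<epsilon> \<noteq> 0" "of_real (\<epsilon> powr - \<gamma>) * (x \<epsilon> * z) = z" if "\<epsilon> > 0" for \<epsilon> z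
    using that by (auto simp: x_def powr_minus)
  show ?thesis
  proof (intro conjI allI impI generic_eigenvalue_counts[OF adm])
    fix lams :: "complex list" and m'
    assume *: "det (aux_pencil d a G) \<noteq> 0 \<and>
        mset lams = {#z \<in># eigenvalues (aux_pencil d a G). z \<noteq> 0#} \<and>
        m' = count (eigenvalues (aux_pencil d a G)) 0"
    \<comment> \<open>With the zeros placed last, the first \<open>length lams\<close> branches have
      nonzero limits and the next \<open>m'\<close> vanish after rescaling; \<open>Z\<close> shifts
      its index accordingly.\<close>
    define zs where "zs = lams @ replicate m' 0"
    have zs: "eigenvalues (aux_pencil d a G) = mset zs"
      using * multiset_partition[of "eigenvalues (aux_pencil d a G)" "\<lambda>z. z \<noteq> 0"]
      by (simp add: zs_def filter_eq_replicate_mset)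
    obtain L W where
      LW: "\<forall>\<^sub>F \<epsilon> in at_right 0. det (pencil d (\<A> \<epsilon>)) \<noteq> 0 \<and> eigenvalues (pencil d (\<A> \<epsilon>)) =
         image_mset (\<lambda>r. of_real (\<epsilon> powr \<gamma>) * r) (mset (map (\<lambda>i. L i \<epsilon>) [0..<length zs]) + W \<epsilon>)"
      and L: "\<And>i. i < length zs \<Longrightarrow> (L i \<longlongrightarrow> zs ! i) (at_right 0)"
      and W: "\<And>R. \<forall>\<^sub>F \<epsilon> in at_right 0. \<forall>\<mu>\<in>#W \<epsilon>. cmod \<mu> > R"
      using eigenvalues_asymptotics[OF lead adm conjunct1[OF *] zs] by blast
    define L' where "L' i \<epsilon> = x \<epsilon> * L i \<epsilon>" for i \<epsilon>
    define Z where "Z i \<epsilon> = x \<epsilon> * L (i + length lams) \<epsilon>" for i \<epsilon>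
    define W' where "W' \<epsilon> = image_mset (\<lambda>r. x \<epsilon> * r) (W \<epsilon>)" for \<epsilon>
    have split: "map f [0..<length zs] = map f [0..<length lams] @ map (\<lambda>i. f (i + length lams)) [0..<m']"
      for f :: "nat \<Rightarrow> complex"
      by (rule nth_equalityI) (auto simp: zs_def nth_append algebra_simps)
    have 1: "\<forall>\<^sub>F \<epsilon> in at_right 0. det (pencil d (\<A> \<epsilon>)) \<noteq> 0 \<and>
        eigenvalues (pencil d (\<A> \<epsilon>)) =
          mset (map (\<lambda>i. L' i \<epsilon>) [0..<length lams]) + mset (map (\<lambda>i. Z i \<epsilon>) [0..<m']) + W' \<epsilon>"
      using LW unfolding split L'_def Z_def W'_def x_def
      by eventually_elim (simp add: image_mset.compositionality o_def)
    have 2: "L' i \<sim>[at_right 0] (\<lambda>\<epsilon>. lams ! i * of_real (\<epsilon> powr \<gamma>))" if "i < length lams" for i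
    proof (rule asymp_equivI')
      have "lams ! i \<in># mset lams"
        using that by simp
      \<comment> \<open>Only a nonzero limit can be divided out to turn convergence into an
        equivalent; for this reason the zero limits are kept apart in \<open>Z\<close>.\<close>
      then have nz: "lams ! i \<noteq> 0"
        using * by auto
      have "(L i \<longlongrightarrow> lams ! i) (at_right 0)"
        using L[of i] that by (simp add: zs_def nth_append)
      then have "((\<lambda>\<epsilon>. L i \<epsilon> / lams ! i) \<longlongrightarrow> lams ! i / lams ! i) (at_right 0)"
        by (intro tendsto_divide tendsto_const nz)
      moreover have "\<forall>\<^sub>F \<epsilon> in at_right 0. L i \<epsilon> / lams ! i = L' i \<epsilon> / (lams ! i * of_real (\<epsilon> powr \<gamma>))"
        using pos by eventually_elim (use x in \<open>simp add: L'_def x_def[symmetric]\<close>)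
      ultimately show "((\<lambda>\<epsilon>. L' i \<epsilon> / (lams ! i * of_real (\<epsilon> powr \<gamma>))) \<longlongrightarrow> 1) (at_right 0)"
        using nz by (auto intro: Lim_transform_eventually)
    qed
    have 3: "((\<lambda>\<epsilon>. of_real (\<epsilon> powr - \<gamma>) * Z i \<epsilon>) \<longlongrightarrow> 0) (at_right 0)" if "i < m'" for i
    proof (rule Lim_transform_eventually)
      show "(L (i + length lams) \<longlongrightarrow> 0) (at_right 0)"
        using L[of "i + length lams"] that by (simp add: zs_def nth_append)
      show "\<forall>\<^sub>F \<epsilon> in at_right 0. L (i + length lams) \<epsilon> = of_real (\<epsilon> powr - \<gamma>) * Z i \<epsilon>"
        using pos by eventually_elim (simp add: Z_def x)
    qed
    have 4: "\<forall>\<^sub>F \<epsilon> in at_right 0. \<forall>\<mu>\<in>#W' \<epsilon>. cmod (of_real (\<epsilon> powr - \<gamma>) * \<mu>) > R" for R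
      using W[of R] pos by eventually_elim (auto simp: W'_def x)
    show "\<exists>L Z W. (\<forall>\<^sub>F \<epsilon> in at_right 0. det (pencil d (\<A> \<epsilon>)) \<noteq> 0 \<and>
           eigenvalues (pencil d (\<A> \<epsilon>)) =
             mset (map (\<lambda>i. L i \<epsilon>) [0..<length lams]) + mset (map (\<lambda>i. Z i \<epsilon>) [0..<m']) + W \<epsilon>) \<and>
        (\<forall>i<length lams. L i \<sim>[at_right 0] (\<lambda>\<epsilon>. lams ! i * of_real (\<epsilon> powr \<gamma>))) \<and>
        (\<forall>i<m'. ((\<lambda>\<epsilon>. of_real (\<epsilon> powr - \<gamma>) * Z i \<epsilon>) \<longlongrightarrow> 0) (at_right 0)) \<and>
        (\<forall>R. \<forall>\<^sub>F \<epsilon> in at_right 0. \<forall>\<mu>\<in>#W \<epsilon>. cmod (of_real (\<epsilon> powr - \<gamma>) * \<mu>) > R)"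
      using 1 2 3 4 by blast
  qed
qed

end
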